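(* Let $G_m$ be a parametric regulatory network and $R$ a well-formed set of influence constraints. For every set of transitions $T\subseteq\Delta(G_m)$, the abstract parametrisation set $p^\#_R(T)$ is the smallest convex sublattice of $\mathbb P(G_m)$ containing $p_R(T)$; i.e. $p^\#_R(T)=[p_R(T)]$, where for $X\subseteq\mathbb P(G_m)$, $[X]$ is the empty lattice if $X=\emptyset$ and otherwise the set $\{P\mid L\le P\le U\}$ with $L,U$ the componentwise minimum and maximum of the elements of $X$.
   Context: An influence graph is $G=(V,I)$ with $V=\{1,\dots,n\}$ and $I\subseteq V\times V$; for $v\in V$ its regulators are $n^-(v)=\{u\mid (u,v)\in I\}$. A vector $m\in\mathbb N^n$ gives maximal values; write $D_v=\{0,\dots,m_v\}$. The pair $G_m=(G,m)$ is a parametric regulatory network (PRN). The regulator states of $v$ are $\Omega_v=\prod_{u\in n^-(v)}D_u$ (vectors indexed by the regulators of $v$); for $\omega\in\Omega_v$, $u\in n^-(v)$ and $k\in D_u$, $\omega[u\leftarrow k]$ is $\omega$ with component $u$ replaced by $k$. The parameters are $\Omega=\bigcup_{v\in V}\{v\}\times\Omega_v$, and a parametrisation is a vector $P\in\mathbb P(G_m)=\prod_{\langle v,\omega\rangle\in\Omega}D_v$ with coordinates $P_{v,\omega}\in D_v$. Parametrisations are ordered componentwise ($P\le P'$ iff $P_{v,\omega}\le P'_{v,\omega}$ for all coordinates); the least element $\bot$ is the zero vector and the greatest $\top$ has $\top_{v,\omega}=m_v$. A pair $(L,U)$ denotes the convex sublattice $\{P\mid L\le P\le U\}$, which is the empty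 lattice $\varnothing$ when $L\not\le U$. States are $S(G_m)=\prod_{v}D_v$; for a state $x$, $\omega_v(x)\in\Omega_v$ is the projection of $x$ onto the regulators of $v$. The transitions $\Delta(G_m)$ are pairs $x\to y$ of states such that for some $v$, $y$ equals $x$ except $y_v=x_v+1\le m_v$ (written $x\xrightarrow{v,+}y$) or $y_v=x_v-1\ge 0$ (written $x\xrightarrow{v,-}y$). For a transition $t$, $\mathcal P_{x\xrightarrow{v,+}y}=\{P\mid P_{v,\omega_v(x)}\ge x_v+1\}$ and $\mathcal P_{x\xrightarrow{v,-}y}=\{P\mid P_{v,\omega_v(x)}\le x_v-1\}$; $p(\emptyset)=\mathbb P(G_m)$ and $p(T)=\bigcap_{t\in T}\mathcal P_t$ for $T\ne\emptyset$. Influence constraints: a set $R\subseteq V\times V\times\{+1,-1,\mathrm o\}$ is well-formed if for all $(u,v,c)\in R$, $u\in n^-(v)$, and no pair $(u,v)$ has both $(u,v,+1)$ and $(u,v,-1)$ in $R$. Define $\mathcal P_{(u,v,+1)}=\{P\mid\forall\omega\in\Omega_v\,\forall x_u\in\{1,\dots,m_u\}: P_{v,\omega[u\leftarrow x_u]}\ge P_{v,\omega[u\leftarrow x_u-1]}\}$, $\mathcal P_{(u,v,-1)}$ likewise with $\le$, and $\mathcal P_{(u,v,\mathrm o)}=\{P\mid\exists\omega\in\Omega_v\,\exists x_u\in\{1,\dots,m_u\}: P_{v,\omega[u\leftarrow x_u]}\ne P_{v,\omega[u\leftarrow x_u-1]}\}$. Let $p_R(T)=p(T)\cap\bigcap_{r\in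 R}\mathcal P_r$. The monotonicity order $\preceq_v$ on $\Omega_v$: $\omega\preceq_v\omega'$ iff for all $u\in n^-(v)$: $\omega_u\le\omega'_u$ if $(u,v,+1)\in R$, $\omega_u\ge\omega'_u$ if $(u,v,-1)\in R$, and $\omega_u=\omega'_u$ otherwise; $\omega\parallel_v\omega'$ means incomparable, and $\prec_v$ is the strict version. Narrowing operators (all map $\varnothing$ to $\varnothing$). For a transition: $\nabla_{x\xrightarrow{v,+}y}(L,U)=(\max(L,\bot[(v,\omega_v(x))\leftarrow x_v+1]),U)$ and $\nabla_{x\xrightarrow{v,-}y}(L,U)=(L,\min(U,\top[(v,\omega_v(x))\leftarrow x_v-1]))$, where $\max,\min$ are componentwise and $Q[(v,\omega)\leftarrow k]$ replaces coordinate $(v,\omega)$ by $k$. For $s\in\{+1,-1\}$, $\nabla_{(u,v,s)}(L,U)$ is the fixpoint of iterating from $(L,U)$ the map $f(L,U)=(L',U')$ with, for all $\omega\in\Omega_v$, $L'_{v,\omega}=\max(\{L_{v,\omega}\}\cup\{L_{v,\omega[u\leftarrow\omega_u-s]}\mid\omega_u-s\in D_u\})$, $U'_{v,\omega}=\min(\{U_{v,\omega}\}\cup\{U_{v,\omega[u\leftarrow\omega_u+s]}\mid\omega_u+s\in D_u\})$, all other coordinates unchanged. For observability, let $A_{u,v}(L,U)=\{\omega\in\Omega_v\mid\exists x_u\in\{1,\dots,m_u\}: L_{v,\omega[u\leftarrow x_u]}<U_{v,\omega[u\leftarrow x_u-1]}\ \text{or}\ U_{v,\omega[u\leftarrow x_u]}>L_{v,\omega[u\leftarrow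 x_u-1]}\}$. Then $\nabla_{(u,v,\mathrm o)}(L,U)=\varnothing$ if $A_{u,v}(L,U)=\emptyset$, and otherwise $(L',U')$ where, writing $A=A_{u,v}(L,U)$, $\overline B=\{\omega\in A\mid L_{v,\omega}<U_{v,\omega}\wedge\forall\omega'\in A: L_{v,\omega}=L_{v,\omega'}\wedge(\omega'\preceq_v\omega\vee\omega\parallel_v\omega')\}$ and $\underline B=\{\omega\in A\mid L_{v,\omega}<U_{v,\omega}\wedge\forall\omega'\in A: U_{v,\omega}=U_{v,\omega'}\wedge(\omega\preceq_v\omega'\vee\omega\parallel_v\omega')\}$; $L'$ is $L$ with coordinate $(v,\omega)$ increased by 1 if $\overline B=\{\omega\}$ and $L'=L$ otherwise; $U'$ is $U$ with coordinate $(v,\omega)$ decreased by 1 if $\underline B=\{\omega\}$ and $U'=U$ otherwise. For a subset $R'\subseteq R$, $\nabla_{R'}(L,U)$ is the fixpoint of iterating from $(L,U)$ the composition of the $\nabla_r$, $r\in R'$. Finally $p^\#_R(\emptyset)=\nabla_R(\bot,\top)$ and $p^\#_R(T\cup\{t\})=\nabla_{\{(u,v',c)\in R\mid v'=v\}}(\nabla_t(p^\#_R(T)))$ where $v$ is the node changed by $t$. *)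

theory Defs
  imports Main
begin

(* Nodes are naturals 0..<n (the paper's 1..n, shifted); objects outside their
   carriers are fixed to 0 (extensional representation). *)

type_synonym rstate = "nat \<Rightarrow> nat"          (* regulator states / global states *)
type_synonym par = "nat \<Rightarrow> rstate \<Rightarrow> nat"   (* parametrisation: P v \<omega> = P_{v,\<omega>} *)
type_synonym lat = "(par \<times> par) option"       (* None = empty lattice, Some (L,U) = (L,U) *)
type_synonym trans = "rstate \<times> rstate"

datatype sgn = Pos | Neg | Obs

definition regs :: "(nat \<times> nat) set \<Rightarrow> nat \<Rightarrow> nat set" where
  "regs I v = {u. (u, v) \<in> I}"

definition Omega_v :: "(nat \<times> nat) set \<Rightarrow> (nat \<Rightarrow> nat) \<Rightarrow> nat \<Rightarrow> rstate set" where
  "Omega_v I m v = {\<omega>. (\<forall>u\<in>regs I v. \<omega> u \<le> m u) \<and> (\<forall>u. u \<notin> regs I v \<longrightarrow> \<omega> u = 0)}"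

definition Params :: "nat \<Rightarrow> (nat \<times> nat) set \<Rightarrow> (nat \<Rightarrow> nat) \<Rightarrow> par set" where
  "Params n I m = {P. \<forall>v \<omega>. if v < n \<and> \<omega> \<in> Omega_v I m v then P v \<omega> \<le> m v else P v \<omega> = 0}"

definition ple :: "nat \<Rightarrow> (nat \<times> nat) set \<Rightarrow> (nat \<Rightarrow> nat) \<Rightarrow> par \<Rightarrow> par \<Rightarrow> bool" where
  "ple n I m P Q = (\<forall>v<n. \<forall>\<omega>\<in>Omega_v I m v. P v \<omega> \<le> Q v \<omega>)"

definition pbot :: par where "pbot = (\<lambda>v \<omega>. 0)"

definition ptop :: "nat \<Rightarrow> (nat \<times> nat) set \<Rightarrow> (nat \<Rightarrow> nat) \<Rightarrow> par" where
  "ptop n I m = (\<lambda>v \<omega>. if v < n \<and> \<omega> \<in> Omega_v I m v then m v else 0)"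

definition pupd :: "par \<Rightarrow> nat \<Rightarrow> rstate \<Rightarrow> nat \<Rightarrow> par" where
  "pupd Q v \<omega> k = Q(v := (Q v)(\<omega> := k))"

definition pmaxf :: "par \<Rightarrow> par \<Rightarrow> par" where "pmaxf P Q = (\<lambda>v \<omega>. max (P v \<omega>) (Q v \<omega>))"
definition pminf :: "par \<Rightarrow> par \<Rightarrow> par" where "pminf P Q = (\<lambda>v \<omega>. min (P v \<omega>) (Q v \<omega>))"

definition denote :: "nat \<Rightarrow> (nat \<times> nat) set \<Rightarrow> (nat \<Rightarrow> nat) \<Rightarrow> lat \<Rightarrow> par set" where
  "denote n I m X = (case X of None \<Rightarrow> {}
      | Some (L, U) \<Rightarrow> {P \<in> Params n I m. ple n I m L P \<and> ple n I m P U})"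

definition hull :: "nat \<Rightarrow> (nat \<times> nat) set \<Rightarrow> (nat \<Rightarrow> nat) \<Rightarrow> par set \<Rightarrow> par set" where
  "hull n I m X = (if X = {} then {} else
     {P \<in> Params n I m. ple n I m (\<lambda>v \<omega>. Min ((\<lambda>Q. Q v \<omega>) ` X)) P
                        \<and> ple n I m P (\<lambda>v \<omega>. Max ((\<lambda>Q. Q v \<omega>) ` X))})"

definition States :: "nat \<Rightarrow> (nat \<Rightarrow> nat) \<Rightarrow> rstate set" where
  "States n m = {x. (\<forall>v<n. x v \<le> m v) \<and> (\<forall>v. n \<le> v \<longrightarrow> x v = 0)}"

definition omega_of :: "(nat \<times> nat) set \<Rightarrow> nat \<Rightarrow> rstate \<Rightarrow> rstate" where
  "omega_of I v x = (\<lambda>u. if u \<in> regs I v then x u else 0)"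

definition Delta :: "nat \<Rightarrow> (nat \<Rightarrow> nat) \<Rightarrow> trans set" where
  "Delta n m = {(x, y). x \<in> States n m \<and> y \<in> States n m \<and>
      (\<exists>v<n. (x v + 1 \<le> m v \<and> y = x(v := x v + 1)) \<or> (1 \<le> x v \<and> y = x(v := x v - 1)))}"

definition tnode :: "trans \<Rightarrow> nat" where
  "tnode t = (THE v. fst t v \<noteq> snd t v)"

definition tup :: "trans \<Rightarrow> bool" where
  "tup t = (fst t (tnode t) < snd t (tnode t))"

definition Ptrans :: "(nat \<times> nat) set \<Rightarrow> trans \<Rightarrow> par set" where
  "Ptrans I t = (let x = fst t; v = tnode t in
     if tup t then {P. P v (omega_of I v x) \<ge> x v + 1}
     else {P. P v (omega_of I v x) \<le> x v - 1})"

definition pT :: "nat \<Rightarrow> (nat \<times> nat) set \<Rightarrow> (nat \<Rightarrow> nat) \<Rightarrow> trans set \<Rightarrow> par set" where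
  "pT n I m T = {P \<in> Params n I m. \<forall>t\<in>T. P \<in> Ptrans I t}"

definition wf_constraints :: "(nat \<times> nat) set \<Rightarrow> (nat \<times> nat \<times> sgn) set \<Rightarrow> bool" where
  "wf_constraints I R = ((\<forall>(u, v, c)\<in>R. (u, v) \<in> I) \<and>
      (\<forall>u v. \<not> ((u, v, Pos) \<in> R \<and> (u, v, Neg) \<in> R)))"

fun Pcon :: "(nat \<times> nat) set \<Rightarrow> (nat \<Rightarrow> nat) \<Rightarrow> nat \<times> nat \<times> sgn \<Rightarrow> par set" where
  "Pcon I m (u, v, Pos) = {P. \<forall>\<omega>\<in>Omega_v I m v. \<forall>xu\<in>{1..m u}.
       P v (\<omega>(u := xu)) \<ge> P v (\<omega>(u := xu - 1))}"
| "Pcon I m (u, v, Neg) = {P. \<forall>\<omega>\<in>Omega_v I m v. \<forall>xu\<in>{1..m u}.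
       P v (\<omega>(u := xu)) \<le> P v (\<omega>(u := xu - 1))}"
| "Pcon I m (u, v, Obs) = {P. \<exists>\<omega>\<in>Omega_v I m v. \<exists>xu\<in>{1..m u}.
       P v (\<omega>(u := xu)) \<noteq> P v (\<omega>(u := xu - 1))}"

definition pR :: "nat \<Rightarrow> (nat \<times> nat) set \<Rightarrow> (nat \<Rightarrow> nat) \<Rightarrow> (nat \<times> nat \<times> sgn) set
                   \<Rightarrow> trans set \<Rightarrow> par set" where
  "pR n I m R T = {P \<in> pT n I m T. \<forall>r\<in>R. P \<in> Pcon I m r}"

definition prec :: "(nat \<times> nat) set \<Rightarrow> (nat \<times> nat \<times> sgn) set \<Rightarrow> nat \<Rightarrow> rstate \<Rightarrow> rstate \<Rightarrow> bool" where
  "prec I R v \<omega> \<omega>' = (\<forall>u\<in>regs I v.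
      (if (u, v, Pos) \<in> R then \<omega> u \<le> \<omega>' u
       else if (u, v, Neg) \<in> R then \<omega> u \<ge> \<omega>' u else \<omega> u = \<omega>' u))"

definition incomp :: "(nat \<times> nat) set \<Rightarrow> (nat \<times> nat \<times> sgn) set \<Rightarrow> nat \<Rightarrow> rstate \<Rightarrow> rstate \<Rightarrow> bool" where
  "incomp I R v \<omega> \<omega>' = (\<not> prec I R v \<omega> \<omega>' \<and> \<not> prec I R v \<omega>' \<omega>)"

definition fixp :: "('a \<Rightarrow> 'a) \<Rightarrow> 'a \<Rightarrow> 'a" where
  "fixp f x = (f ^^ (LEAST k. f ((f ^^ k) x) = (f ^^ k) x)) x"

definition nabla_trans :: "nat \<Rightarrow> (nat \<times> nat) set \<Rightarrow> (nat \<Rightarrow> nat) \<Rightarrow> trans \<Rightarrow> lat \<Rightarrow> lat" where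
  "nabla_trans n I m t X = (case X of None \<Rightarrow> None
     | Some (L, U) \<Rightarrow> (let x = fst t; v = tnode t; w = omega_of I v x in
         if tup t then Some (pmaxf L (pupd pbot v w (x v + 1)), U)
         else Some (L, pminf U (pupd (ptop n I m) v w (x v - 1)))))"

(* one step f of the sign narrowing, s \<in> {1, -1} *)
definition sgn_step :: "(nat \<times> nat) set \<Rightarrow> (nat \<Rightarrow> nat) \<Rightarrow> nat \<Rightarrow> nat \<Rightarrow> int
                        \<Rightarrow> par \<times> par \<Rightarrow> par \<times> par" where
  "sgn_step I m u v s LU = (let L = fst LU; U = snd LU in
     ((\<lambda>v' \<omega>. if v' = v \<and> \<omega> \<in> Omega_v I m v then
         Max ({L v \<omega>} \<union> (if 0 \<le> int (\<omega> u) - s \<and> int (\<omega> u) - s \<le> int (m u)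
                         then {L v (\<omega>(u := nat (int (\<omega> u) - s)))} else {}))
       else L v' \<omega>),
      (\<lambda>v' \<omega>. if v' = v \<and> \<omega> \<in> Omega_v I m v then
         Min ({U v \<omega>} \<union> (if 0 \<le> int (\<omega> u) + s \<and> int (\<omega> u) + s \<le> int (m u)
                         then {U v (\<omega>(u := nat (int (\<omega> u) + s)))} else {}))
       else U v' \<omega>)))"

definition nabla_sign :: "(nat \<times> nat) set \<Rightarrow> (nat \<Rightarrow> nat) \<Rightarrow> nat \<Rightarrow> nat \<Rightarrow> int \<Rightarrow> lat \<Rightarrow> lat" where
  "nabla_sign I m u v s X = (case X of None \<Rightarrow> None | Some LU \<Rightarrow> Some (fixp (sgn_step I m u v s) LU))"

definition Aset :: "(nat \<times> nat) set \<Rightarrow> (nat \<Rightarrow> nat) \<Rightarrow> nat \<Rightarrow> nat \<Rightarrow> par \<Rightarrow> par \<Rightarrow> rstate set" where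
  "Aset I m u v L U = {\<omega> \<in> Omega_v I m v. \<exists>xu\<in>{1..m u}.
      L v (\<omega>(u := xu)) < U v (\<omega>(u := xu - 1)) \<or> U v (\<omega>(u := xu)) > L v (\<omega>(u := xu - 1))}"

definition Bover :: "(nat \<times> nat) set \<Rightarrow> (nat \<times> nat \<times> sgn) set \<Rightarrow> nat \<Rightarrow> rstate set
                     \<Rightarrow> par \<Rightarrow> par \<Rightarrow> rstate set" where
  "Bover I R v A L U = {\<omega> \<in> A. L v \<omega> < U v \<omega> \<and>
      (\<forall>\<omega>'\<in>A. L v \<omega> = L v \<omega>' \<and> (prec I R v \<omega>' \<omega> \<or> incomp I R v \<omega> \<omega>'))}"

definition Bunder :: "(nat \<times> nat) set \<Rightarrow> (nat \<times> nat \<times> sgn) set \<Rightarrow> nat \<Rightarrow> rstate set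
                      \<Rightarrow> par \<Rightarrow> par \<Rightarrow> rstate set" where
  "Bunder I R v A L U = {\<omega> \<in> A. L v \<omega> < U v \<omega> \<and>
      (\<forall>\<omega>'\<in>A. U v \<omega> = U v \<omega>' \<and> (prec I R v \<omega> \<omega>' \<or> incomp I R v \<omega> \<omega>'))}"

definition nabla_obs :: "(nat \<times> nat) set \<Rightarrow> (nat \<Rightarrow> nat) \<Rightarrow> (nat \<times> nat \<times> sgn) set
                         \<Rightarrow> nat \<Rightarrow> nat \<Rightarrow> lat \<Rightarrow> lat" where
  "nabla_obs I m R u v X = (case X of None \<Rightarrow> None
     | Some (L, U) \<Rightarrow> (let A = Aset I m u v L U; Bo = Bover I R v A L U; Bu = Bunder I R v A L U in
         if A = {} then None
         else Some (if (\<exists>\<omega>. Bo = {\<omega>}) then pupd L v (the_elem Bo) (L v (the_elem Bo) + 1) else L,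
                    if (\<exists>\<omega>. Bu = {\<omega>}) then pupd U v (the_elem Bu) (U v (the_elem Bu) - 1) else U)))"

fun nabla_con :: "(nat \<times> nat) set \<Rightarrow> (nat \<Rightarrow> nat) \<Rightarrow> (nat \<times> nat \<times> sgn) set
                  \<Rightarrow> nat \<times> nat \<times> sgn \<Rightarrow> lat \<Rightarrow> lat" where
  "nabla_con I m R (u, v, Pos) = nabla_sign I m u v 1"
| "nabla_con I m R (u, v, Neg) = nabla_sign I m u v (-1)"
| "nabla_con I m R (u, v, Obs) = nabla_obs I m R u v"

(* \<nabla>_{R'} for R' given as a list (fixing the order of composition) *)
definition nabla_set :: "(nat \<times> nat) set \<Rightarrow> (nat \<Rightarrow> nat) \<Rightarrow> (nat \<times> nat \<times> sgn) set
                         \<Rightarrow> (nat \<times> nat \<times> sgn) list \<Rightarrow> lat \<Rightarrow> lat" where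
  "nabla_set I m R rs X = fixp (foldr (\<lambda>r g. nabla_con I m R r \<circ> g) rs id) X"

(* p^#_R(T) for T given as a list of transitions ts (head = last added);
   rl is an enumeration of R *)
fun psharp :: "nat \<Rightarrow> (nat \<times> nat) set \<Rightarrow> (nat \<Rightarrow> nat) \<Rightarrow> (nat \<times> nat \<times> sgn) set
               \<Rightarrow> (nat \<times> nat \<times> sgn) list \<Rightarrow> trans list \<Rightarrow> lat" where
  "psharp n I m R rl [] = nabla_set I m R rl (Some (pbot, ptop n I m))"
| "psharp n I m R rl (t # ts) =
     nabla_set I m R (filter (\<lambda>(u, v', c). v' = tnode t) rl) (nabla_trans n I m t (psharp n I m R rl ts))"

end

theory Submission
  imports Defs
begin

text \<open>
  Soundness: each narrowing operator keeps every parametrisation satisfying its constraint. For an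
  observability constraint on u with unique maximal element p of the free part of A, suppose a
  monotone P had P(p) = L(p); every point of A lies below p or below a point where L = U,
  so P would equal the constant value of L on A, and hence ignore u.

  Tightness: at a fixpoint with L \<open>\<le>\<close> U, suppose every monotone function in the box
  with value L(p) at p ignores some observable regulator. If there were two such functions, there
  would be two that differ at a single point, which is impossible when each of them ignores a
  regulator. So L is the only one; it ignores some observable u, every free point lies
  below p, and p is then the unique element of the set \<open>Bover\<close> for u,
  so the pair (L, U) was not a fixpoint. Upper bounds are dual: negate all values and reverse
  the monotonicity order, which is why this part is carried out over the integers.
\<close>

section \<open>Monotone functions between bounds on the regulator states of one node\<close>

definition depends :: "rstate set \<Rightarrow> (nat \<Rightarrow> nat) \<Rightarrow> nat \<Rightarrow> (rstate \<Rightarrow> 'b) \<Rightarrow> bool" where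
  "depends \<Omega> m u f = (\<exists>\<omega>\<in>\<Omega>. \<exists>x\<in>{1..m u}. f (\<omega>(u := x)) \<noteq> f (\<omega>(u := x - 1)))"

text \<open>The set \<open>A\<close> of an observability constraint with integer bounds, so that
  \<open>L\<close> and \<open>U\<close> can be replaced by \<open>-U\<close> and
  \<open>-L\<close>.\<close>

definition varies :: "rstate set \<Rightarrow> (nat \<Rightarrow> nat) \<Rightarrow> nat \<Rightarrow> (rstate \<Rightarrow> int) \<Rightarrow> (rstate \<Rightarrow> int) \<Rightarrow> rstate set" where
  "varies \<Omega> m u L U = {\<omega> \<in> \<Omega>. \<exists>x\<in>{1..m u}.
     L (\<omega>(u := x)) < U (\<omega>(u := x - 1)) \<or> U (\<omega>(u := x)) > L (\<omega>(u := x - 1))}"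

text \<open>The set \<open>Bover\<close>, where "below or incomparable" is rewritten as maximality
  of \<omega>. With negated, exchanged bounds and the reversed order it becomes
  \<open>Bunder\<close>.\<close>

definition peaks :: "(rstate \<Rightarrow> rstate \<Rightarrow> bool) \<Rightarrow> rstate set \<Rightarrow> (rstate \<Rightarrow> int) \<Rightarrow> (rstate \<Rightarrow> int) \<Rightarrow> rstate set" where
  "peaks le A L U = {\<omega> \<in> A. L \<omega> < U \<omega> \<and> (\<forall>\<omega>'\<in>A. L \<omega> = L \<omega>' \<and> (le \<omega> \<omega>' \<longrightarrow> le \<omega>' \<omega>))}"

text \<open>Abstracts the states of one node, \<open>N\<close> standing for its regulators. The
  partial order is left open so that every result can be reused with the order reversed.\<close>

locale regulator_order =
  fixes \<Omega> :: "rstate set" and le :: "rstate \<Rightarrow> rstate \<Rightarrow> bool" and m :: "nat \<Rightarrow> nat" and N :: "nat set"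
  assumes fin: "finite \<Omega>"
    and upd: "\<And>\<omega> u k. \<omega> \<in> \<Omega> \<Longrightarrow> u \<in> N \<Longrightarrow> k \<le> m u \<Longrightarrow> \<omega>(u := k) \<in> \<Omega>"
    and bounded: "\<And>\<omega> u. \<omega> \<in> \<Omega> \<Longrightarrow> u \<in> N \<Longrightarrow> \<omega> u \<le> m u"
    and le_refl: "\<And>a. a \<in> \<Omega> \<Longrightarrow> le a a"
    and le_trans: "\<And>a b c. a \<in> \<Omega> \<Longrightarrow> b \<in> \<Omega> \<Longrightarrow> c \<in> \<Omega> \<Longrightarrow> le a b \<Longrightarrow> le b c \<Longrightarrow> le a c"
    and le_antisym: "\<And>a b. a \<in> \<Omega> \<Longrightarrow> b \<in> \<Omega> \<Longrightarrow> le a b \<Longrightarrow> le b a \<Longrightarrow> a = b"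
begin

lemma dual: "regulator_order \<Omega> (\<lambda>a b. le b a) m N"
  by unfold_locales (use fin upd bounded le_refl le_trans le_antisym in blast)+

text \<open>In a finite partial order, moving to a strictly larger element of \<open>A\<close>
  shrinks the set of elements above, so the climb ends.\<close>

lemma maximal_above:
  assumes "A \<subseteq> \<Omega>" "a \<in> A"
  shows "\<exists>b\<in>A. le a b \<and> (\<forall>z\<in>A. le b z \<longrightarrow> z = b)"
  using assms(2)
proof (induction "card {z \<in> A. le a z}" arbitrary: a rule: less_induct)
  case less
  show ?case
  proof (cases "\<forall>z\<in>A. le a z \<longrightarrow> z = a")
    case True
    then show ?thesis using less.prems assms(1) le_refl by blast
  next
    case False
    then obtain z where z: "z \<in> A" "le a z" "z \<noteq> a" by blast
    have "{y \<in> A. le z y} \<subset> {y \<in> A. le a y}"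
    proof
      show "{y \<in> A. le z y} \<subseteq> {y \<in> A. le a y}"
        using z less.prems assms(1) le_trans by blast
      have "\<not> le z a" using z less.prems assms(1) le_antisym by blast
      then show "{y \<in> A. le z y} \<noteq> {y \<in> A. le a y}"
        using less.prems assms(1) le_refl by blast
    qed
    then have "card {y \<in> A. le z y} < card {y \<in> A. le a y}"
      using fin assms(1) by (intro psubset_card_mono) (auto intro: finite_subset)
    from less.hyps[OF this z(1)] obtain b where
      "b \<in> A" "le z b" "\<forall>y\<in>A. le b y \<longrightarrow> y = b" by blast
    then show ?thesis using z less.prems assms(1) le_trans by (metis subsetD)
  qed
qed

text \<open>Unit steps telescope down to coordinate 0; \<open>f \<omega>\<close> itself is the case
  \<open>k = \<omega> u\<close>.\<close>

lemma constant_line: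
  assumes "\<not> depends \<Omega> m u f" "\<omega> \<in> \<Omega>" "u \<in> N" "k \<le> m u"
  shows "f (\<omega>(u := k)) = f \<omega>"
proof -
  have *: "f (\<omega>(u := k)) = f (\<omega>(u := 0))" if "k \<le> m u" for k
    using that
  proof (induction k)
    case (Suc k)
    have "Suc k \<in> {1..m u}" using Suc.prems by simp
    then have "f (\<omega>(u := Suc k)) = f (\<omega>(u := Suc k - 1))"
      using assms(1,2) unfolding depends_def by blast
    then show ?case using Suc by (metis Suc_leD diff_Suc_1)
  qed simp
  show ?thesis using *[OF assms(4)] *[OF bounded[OF assms(2,3)]] by simp
qed

text \<open>Membership reads \<omega> only through updates at \<open>u\<close>, so the set is a
  union of full lines in direction \<open>u\<close>.\<close>

lemma varies_update:
  assumes "\<omega> \<in> varies \<Omega> m u L U" "u \<in> N" "k \<le> m u"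
  shows "\<omega>(u := k) \<in> varies \<Omega> m u L U"
  using assms upd by (auto simp: varies_def)

lemma unique_peak_sound:
  assumes u: "u \<in> N" and peak: "peaks le (varies \<Omega> m u L U) L U = {p}"
    and box: "\<And>\<omega>. \<omega> \<in> \<Omega> \<Longrightarrow> L \<omega> \<le> f \<omega> \<and> f \<omega> \<le> U \<omega>"
    and mono: "monotone_on \<Omega> le (\<le>) f" and dep: "depends \<Omega> m u f"
  shows "L p < f p"
proof (rule ccontr)
  let ?A = "varies \<Omega> m u L U"
  have A: "?A \<subseteq> \<Omega>" by (auto simp: varies_def)
  have p: "p \<in> ?A" and Lp: "\<And>\<omega>. \<omega> \<in> ?A \<Longrightarrow> L \<omega> = L p"
  proof -
    have "p \<in> peaks le ?A L U" using peak by simp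
    then have "p \<in> ?A \<and> (\<forall>\<omega>\<in>?A. L p = L \<omega>)" unfolding peaks_def by blast
    then show "p \<in> ?A" "\<And>\<omega>. \<omega> \<in> ?A \<Longrightarrow> L \<omega> = L p" by auto
  qed
  assume "\<not> L p < f p"
  then have fp: "f p = L p" using box[of p] p A by force
  \<comment> \<open>Climb to a maximal point \<open>b\<close> of \<open>A\<close>. If
    \<open>L b < U b\<close>, then \<open>b\<close> is a peak, as \<open>L\<close> is constant on
    \<open>A\<close>, hence \<open>b = p\<close>; otherwise the box pins \<open>f b\<close> to
    \<open>L b\<close>. Either way \<open>f \<omega> \<le> f b = L p\<close>.\<close>
  have const: "f \<omega> = L p" if \<omega>: "\<omega> \<in> ?A" for \<omega>
  proof -
    obtain b where b: "b \<in> ?A" "le \<omega> b" "\<forall>z\<in>?A. le b z \<longrightarrow> z = b"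
      using maximal_above[OF A \<omega>] by blast
    have "f \<omega> \<le> f b" using mono \<omega> b A by (auto simp: monotone_on_def)
    moreover have "f b = L p"
    proof (cases "L b < U b")
      case True
      then have "b \<in> peaks le ?A L U" using b Lp A le_refl by (auto simp: peaks_def)
      then show ?thesis using peak fp by auto
    next
      case False
      then show ?thesis using box[of b] Lp[OF b(1)] b A by force
    qed
    ultimately show ?thesis using box[of \<omega>] Lp[OF \<omega>] \<omega> A by force
  qed
  from dep obtain \<omega> x where \<omega>: "\<omega> \<in> \<Omega>" "x \<in> {1..m u}" "f (\<omega>(u := x)) \<noteq> f (\<omega>(u := x - 1))"
    by (auto simp: depends_def)
  have in\<Omega>: "\<omega>(u := x) \<in> \<Omega>" "\<omega>(u := x - 1) \<in> \<Omega>" using \<omega> u upd by auto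
  show False
  proof (cases "\<omega> \<in> ?A")
    case True
    have "\<omega>(u := x) \<in> ?A" "\<omega>(u := x - 1) \<in> ?A"
      using varies_update[OF True u] \<omega>(2) by auto
    then show False using const \<omega>(3) by simp
  next
    case False
    \<comment> \<open>Writing only the value of \<open>u\<close>, the chain \<open>f x \<le> U x
      \<le> L (x-1) \<le> f (x-1) \<le> U (x-1) \<le> L x \<le> f x\<close> forces equality.\<close>
    then have "L (\<omega>(u := x)) \<ge> U (\<omega>(u := x - 1))" "U (\<omega>(u := x)) \<le> L (\<omega>(u := x - 1))"
      using \<omega> by (auto simp: varies_def not_less)
    then show False using box[OF in\<Omega>(1)] box[OF in\<Omega>(2)] \<omega>(3) by linarith
  qed
qed

text \<open>Changing a function at a single point cannot lead from one function ignoring a regulator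
  to another such function: this prevents several observability constraints from jointly
  excluding a value that none of them excludes alone.\<close>

lemma single_change_depends:
  assumes "u \<in> N" "u' \<in> N" "0 < m u" "0 < m u'" "q \<in> \<Omega>" "c \<noteq> f q"
    and "\<not> depends \<Omega> m u f"
  shows "depends \<Omega> m u' (f(q := c))"
proof (rule ccontr)
  let ?g = "f(q := c)"
  assume g: "\<not> depends \<Omega> m u' ?g"
  define k where "k = (if q u = 0 then 1 else 0 :: nat)"
  define k' where "k' = (if q u' = 0 then 1 else 0 :: nat)"
  have k: "k \<noteq> q u" "k \<le> m u" "k' \<noteq> q u'" "k' \<le> m u'"
    using assms by (auto simp: k_def k'_def)
  have ne: "q(u := k) \<noteq> q" "q(u' := k') \<noteq> q" using k by (metis fun_upd_same)+
  show False
  proof (cases "u = u'")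
    case True
    have "c = ?g (q(u' := k'))" using constant_line[OF g assms(5,2) k(4)] by simp
    also have "\<dots> = f (q(u' := k'))" using ne by simp
    also have "\<dots> = f q" using constant_line[OF assms(7,5,1), of k'] k True by simp
    finally show False using assms by simp
  next
    case False
    \<comment> \<open>A rectangle with corners \<open>q\<close>, \<open>q(u' := k')\<close>,
      \<open>?r\<close>, \<open>q(u := k)\<close>. \<open>f\<close> and \<open>?g\<close> agree
      except at \<open>q\<close>, \<open>?g\<close> is constant along \<open>u'\<close> and
      \<open>f\<close> along \<open>u\<close>, so going around carries \<open>c\<close> to
      \<open>f q\<close>.\<close>
    let ?r = "q(u := k, u' := k')"
    have r: "?r \<noteq> q" "?r = q(u' := k', u := k)" using k False by (auto simp: fun_eq_iff)
    have "c = ?g (q(u' := k'))" using constant_line[OF g assms(5,2) k(4)] by simp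
    also have "\<dots> = f (q(u' := k'))" using ne by simp
    also have "\<dots> = f ?r" using constant_line[OF assms(7) upd[OF assms(5,2) k(4)] assms(1) k(2)] r by simp
    also have "\<dots> = ?g ?r" using r by simp
    also have "\<dots> = ?g (q(u := k))"
      using constant_line[OF g upd[OF assms(5,1) k(2)] assms(2) k(4)] by simp
    also have "\<dots> = f (q(u := k))" using ne by simp
    also have "\<dots> = f q" using constant_line[OF assms(7,5,1) k(2)] .
    finally show False using assms by simp
  qed
qed

lemma lower_bound_attained:
  assumes "S \<subseteq> N" and p: "p \<in> \<Omega>"
    and box: "\<And>\<omega>. \<omega> \<in> \<Omega> \<Longrightarrow> L \<omega> \<le> U \<omega>"
    and L: "monotone_on \<Omega> le (\<le>) L" and U: "monotone_on \<Omega> le (\<le>) U"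
    and A: "\<And>u. u \<in> S \<Longrightarrow> varies \<Omega> m u L U \<noteq> {}"
    and B: "\<And>u. u \<in> S \<Longrightarrow> peaks le (varies \<Omega> m u L U) L U \<noteq> {p}"
  shows "\<exists>f. monotone_on \<Omega> le (\<le>) f \<and> (\<forall>\<omega>\<in>\<Omega>. L \<omega> \<le> f \<omega> \<and> f \<omega> \<le> U \<omega>) \<and> f p = L p
    \<and> (\<forall>u\<in>S. depends \<Omega> m u f)"
proof (rule ccontr)
  assume neg: "\<not> ?thesis"
  have no: "\<exists>u\<in>S. \<not> depends \<Omega> m u f"
    if "monotone_on \<Omega> le (\<le>) f" "\<And>\<omega>. \<omega> \<in> \<Omega> \<Longrightarrow> L \<omega> \<le> f \<omega> \<and> f \<omega> \<le> U \<omega>" "f p = L p" for f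
    using neg that by blast
  obtain u where u: "u \<in> S" "\<not> depends \<Omega> m u L" using no[OF L] box by auto
  have uN: "u \<in> N" using u assms(1) by auto
  have pos: "0 < m w" if "w \<in> S" for w using A[OF that] by (auto simp: varies_def)
  \<comment> \<open>the largest monotone function below U taking the value L p at p\<close>
  define V where "V q = (if le q p then min (U q) (L p) else U q)" for q
  have V: "monotone_on \<Omega> le (\<le>) V"
    unfolding monotone_on_def
  proof (intro ballI impI)
    fix a b assume ab: "a \<in> \<Omega>" "b \<in> \<Omega>" "le a b"
    have "U a \<le> U b" using U ab by (auto simp: monotone_on_def)
    moreover have "le b p \<Longrightarrow> le a p" using le_trans[OF ab(1,2) p ab(3)] .
    ultimately show "V a \<le> V b" by (auto simp: V_def)
  qed
  have LV: "L q \<le> V q \<and> V q \<le> U q" if "q \<in> \<Omega>" for q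
    using box[OF that] L that p by (auto simp: V_def monotone_on_def)
  have Vp: "V p = L p" using box[OF p] le_refl[OF p] by (simp add: V_def)
  \<comment> \<open>Otherwise take a maximal \<open>b\<close> with \<open>L b < V b\<close>; it is
    not \<open>p\<close>. Strictly above \<open>b\<close> the functions \<open>L\<close> and
    \<open>V\<close> agree, so raising \<open>L\<close> to \<open>V b\<close> at \<open>b\<close>
    alone stays monotone. Both \<open>L\<close> and the raised function then ignore some regulator
    in \<open>S\<close>, contradicting \<open>single_change_depends\<close>.\<close>
  have eq: "V q = L q" if "q \<in> \<Omega>" for q
  proof (rule ccontr)
    assume "V q \<noteq> L q"
    then have "q \<in> {q \<in> \<Omega>. L q < V q}" using that LV by force
    from maximal_above[OF _ this] obtain b where
      b: "b \<in> \<Omega>" "L b < V b" and max: "\<And>z. z \<in> \<Omega> \<Longrightarrow> L z < V z \<Longrightarrow> le b z \<Longrightarrow> z = b"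
      by auto
    let ?g = "L(b := V b)"
    have "monotone_on \<Omega> le (\<le>) ?g"
      unfolding monotone_on_def
    proof (intro ballI impI)
      fix x y assume xy: "x \<in> \<Omega>" "y \<in> \<Omega>" "le x y"
      show "?g x \<le> ?g y"
      proof (cases "x = b")
        case True
        have "y = b \<or> L y = V y" using max[of y] LV[of y] xy True by force
        then show ?thesis using V xy True by (auto simp: monotone_on_def)
      next
        case False
        then show ?thesis using L xy b by (force simp: monotone_on_def)
      qed
    qed
    moreover have "L \<omega> \<le> ?g \<omega> \<and> ?g \<omega> \<le> U \<omega>" if "\<omega> \<in> \<Omega>" for \<omega>
      using box[OF that] LV[OF that] by auto
    moreover have "?g p = L p" using b Vp by auto
    ultimately obtain w where w: "w \<in> S" "\<not> depends \<Omega> m w ?g" using no by blast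
    moreover have "depends \<Omega> m w ?g"
      using w u b assms(1) pos by (intro single_change_depends[of u]) auto
    ultimately show False by simp
  qed
  have line: "L (\<omega>(u := k)) = L \<omega>" if "\<omega> \<in> \<Omega>" "k \<le> m u" for \<omega> k
    using constant_line[OF u(2) that(1) uN that(2)] .
  \<comment> \<open>With \<open>V = L\<close>, a point where \<open>L < U\<close> must fall into the
    first branch of \<open>V\<close>.\<close>
  have free: "le q p \<and> L q = L p" if "q \<in> \<Omega>" "L q < U q" for q
    using eq[OF that(1)] that by (auto simp: V_def min_def split: if_splits)
  let ?A = "varies \<Omega> m u L U"
  \<comment> \<open>\<open>L\<close> is constant along \<open>u\<close>, so a strict inequality
    between neighbouring points becomes \<open>L < U\<close> at one of them.\<close>
  have A_free: "\<exists>q\<in>\<Omega>. L q < U q \<and> L \<omega> = L p" if \<omega>: "\<omega> \<in> ?A" for \<omega>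
  proof -
    obtain x where x: "\<omega> \<in> \<Omega>" "x \<in> {1..m u}"
      "L (\<omega>(u := x)) < U (\<omega>(u := x - 1)) \<or> U (\<omega>(u := x)) > L (\<omega>(u := x - 1))"
      using \<omega> unfolding varies_def by blast
    have in\<Omega>: "\<omega>(u := x) \<in> \<Omega>" "\<omega>(u := x - 1) \<in> \<Omega>" using x uN upd by auto
    have l: "L (\<omega>(u := x)) = L \<omega>" "L (\<omega>(u := x - 1)) = L \<omega>" using line x by auto
    from x(3) show ?thesis
    proof
      assume "L (\<omega>(u := x)) < U (\<omega>(u := x - 1))"
      then show ?thesis using l in\<Omega> free by metis
    next
      assume "U (\<omega>(u := x)) > L (\<omega>(u := x - 1))"
      then show ?thesis using l in\<Omega> free by metis
    qed
  qed
  obtain q where q: "q \<in> \<Omega>" "L q < U q" using A[OF u(1)] A_free by blast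
  have Lp: "L p < U p"
    using free[OF q] q U p by (force simp: monotone_on_def)
  \<comment> \<open>Chosen so that \<open>k\<close> is at least 1 and one of \<open>k - 1\<close>,
    \<open>k\<close> is the current value \<open>p u\<close>; this puts \<open>p\<close> itself into
    \<open>?A\<close>.\<close>
  define k where "k = (if p u = 0 then 1 else p u)"
  have k: "k \<in> {1..m u}" "p u = k \<or> p u = k - 1"
    using bounded[OF p uN] pos[OF u(1)] by (auto simp: k_def)
  have Lk: "L (p(u := k)) = L p" "L (p(u := k - 1)) = L p" using line[OF p] k(1) by auto
  have "U (p(u := k)) = U p \<or> U (p(u := k - 1)) = U p" using k(2) fun_upd_triv[of p u] by metis
  then have "L (p(u := k)) < U (p(u := k - 1)) \<or> U (p(u := k)) > L (p(u := k - 1))"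
    using Lp Lk by auto
  then have pA: "p \<in> ?A" unfolding varies_def using p k(1) by blast
  \<comment> \<open>A point of \<open>?A\<close> above \<open>p\<close> inherits
    \<open>L < U\<close> from \<open>p\<close>, as \<open>U\<close> is monotone, so it is also below
    \<open>p\<close>. Conversely any peak has \<open>L < U\<close>, hence lies below
    \<open>p\<close>, and its maximality makes it equal to \<open>p\<close>.\<close>
  have "peaks le ?A L U = {p}"
  proof
    have "le \<omega> p" if "\<omega> \<in> ?A" "le p \<omega>" for \<omega>
    proof -
      have w: "\<omega> \<in> \<Omega>" using that by (auto simp: varies_def)
      have "L \<omega> = L p" using A_free[OF that(1)] by blast
      moreover have "U p \<le> U \<omega>" using U p w that by (auto simp: monotone_on_def)
      ultimately show ?thesis using free[OF w] Lp by simp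
    qed
    moreover have "L p = L \<omega>" if "\<omega> \<in> ?A" for \<omega> using A_free[OF that] by auto
    ultimately show "{p} \<subseteq> peaks le ?A L U" unfolding peaks_def using pA Lp by blast
    show "peaks le ?A L U \<subseteq> {p}"
    proof
      fix \<omega> assume \<omega>: "\<omega> \<in> peaks le ?A L U"
      then have w: "\<omega> \<in> \<Omega>" "le \<omega> p" using free[of \<omega>] by (auto simp: peaks_def varies_def)
      then have "le p \<omega>" using \<omega> pA by (auto simp: peaks_def)
      then show "\<omega> \<in> {p}" using le_antisym w p by blast
    qed
  qed
  then show False using B[OF u(1)] by simp
qed

end

section \<open>Iteration to a fixpoint on a finite set\<close>

text \<open>\<open>fixp\<close> stops at the least stationary index, so one must exist: in a finite
  set the orbit repeats at some \<open>i < j\<close>, and \<open>le\<close> squeezes iterate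
  \<open>i + 1\<close> between these equal iterates. The relation is a parameter because
  \<open>narrows\<close> depends on a set of nodes.\<close>

lemma fixp_decreasing:
  fixes le :: "'a \<Rightarrow> 'a \<Rightarrow> bool"
  assumes refl: "reflp le" and trans: "transp le" and antisym: "antisymp le"
    and S: "finite S" "x \<in> S" and step: "\<And>y. y \<in> S \<Longrightarrow> f y \<in> S \<and> le y (f y)"
  shows "f (fixp f x) = fixp f x" "fixp f x \<in> S" "le x (fixp f x)"
proof -
  have orbit: "(f ^^ k) x \<in> S" for k by (induction k) (use S step in auto)
  have le_add: "le ((f ^^ i) x) ((f ^^ (i + d)) x)" for i d
  proof (induction d)
    case (Suc d)
    then show ?case using step[OF orbit[of "i + d"]] transpD[OF trans] by auto
  qed (simp add: reflpD[OF refl])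
  have "\<not> inj (\<lambda>k. (f ^^ k) x)"
    using S(1) orbit finite_subset[of "range (\<lambda>k. (f ^^ k) x)" S] finite_imageD infinite_UNIV_nat by blast
  then obtain i j where ij: "i < j" "(f ^^ i) x = (f ^^ j) x"
    unfolding inj_def by (metis linorder_neqE_nat)
  obtain d where "j = Suc i + d" using ij(1) less_iff_Suc_add by auto
  then have "le (f ((f ^^ i) x)) ((f ^^ i) x)" using le_add[of "Suc i" d] ij(2) by simp
  moreover have "le ((f ^^ i) x) (f ((f ^^ i) x))" using step orbit by blast
  ultimately have "f ((f ^^ i) x) = (f ^^ i) x" using antisympD[OF antisym] by blast
  then show "f (fixp f x) = fixp f x" unfolding fixp_def by (rule LeastI)
  show "fixp f x \<in> S" "le x (fixp f x)" unfolding fixp_def using orbit le_add[of 0] by simp_all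
qed

text \<open>\<open>fixp f x\<close> is by definition an iterate of \<open>f\<close>, stationary or
  not, so invariants pass to it without a termination argument.\<close>

lemma fixp_invariant:
  assumes "Q x" "\<And>y. Q y \<Longrightarrow> Q (f y)"
  shows "Q (fixp f x)"
proof -
  have "Q ((f ^^ k) x)" for k by (induction k) (use assms in auto)
  then show ?thesis by (simp add: fixp_def)
qed

section \<open>Finiteness of regulator states and parametrisations\<close>

lemma finite_regs: "finite I \<Longrightarrow> finite (regs I v)"
  using finite_imageI[of I fst] by (rule rev_finite_subset) (force simp: regs_def)+

text \<open>The value 0 off the regulators makes the set finite; the union of all ranges is the
  single codomain wanted by \<open>finite_set_of_finite_funs\<close>.\<close>

lemma finite_Omega_v:
  assumes "finite I"
  shows "finite (Omega_v I m v)"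
proof -
  have "finite (regs I v)" using assms by (rule finite_regs)
  then have "finite {\<omega>. \<forall>u. (u \<in> regs I v \<longrightarrow> \<omega> u \<in> (\<Union>u\<in>regs I v. {..m u}))
      \<and> (u \<notin> regs I v \<longrightarrow> \<omega> u = 0)}"
    by (intro finite_set_of_finite_funs) auto
  then show ?thesis by (rule rev_finite_subset) (auto simp: Omega_v_def)
qed

lemma finite_Params:
  assumes "finite I"
  shows "finite (Params n I m)"
proof -
  let ?A = "Sigma {..<n} (Omega_v I m)"
  let ?F = "{f. \<forall>x. (x \<in> ?A \<longrightarrow> f x \<in> (\<Union>v<n. {..m v})) \<and> (x \<notin> ?A \<longrightarrow> f x = 0)}"
  have "finite ?F"
    using finite_Omega_v[OF assms] by (intro finite_set_of_finite_funs) auto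
  \<comment> \<open>Uncurrying gives functions of one argument, a pair of node and regulator state,
    that vanish off a finite set.\<close>
  moreover have "case_prod ` Params n I m \<subseteq> ?F"
    by (auto simp: Params_def split: if_splits)
  ultimately have "finite (case_prod ` Params n I m)" by (rule rev_finite_subset)
  moreover have "inj_on case_prod (Params n I m)" by (auto intro!: inj_onI simp: fun_eq_iff)
  ultimately show ?thesis using finite_imageD by blast
qed

lemma Params_le: "P \<in> Params n I m \<Longrightarrow> P v \<omega> \<le> m v"
  by (auto simp: Params_def split: if_splits) (metis zero_le)

lemma Params_outside: "P \<in> Params n I m \<Longrightarrow> \<not> (v < n \<and> \<omega> \<in> Omega_v I m v) \<Longrightarrow> P v \<omega> = 0"
  unfolding Params_def by (metis (mono_tags, lifting) mem_Collect_eq)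

lemma ParamsI:
  assumes "\<And>v \<omega>. v < n \<Longrightarrow> \<omega> \<in> Omega_v I m v \<Longrightarrow> P v \<omega> \<le> m v"
    and "\<And>v \<omega>. \<not> (v < n \<and> \<omega> \<in> Omega_v I m v) \<Longrightarrow> P v \<omega> = 0"
  shows "P \<in> Params n I m"
  using assms by (auto simp: Params_def)

section \<open>The narrowing order on lattices\<close>

text \<open>Compares stored bounds rather than denoted sets: many pairs denote the empty lattice, so
  inclusion of denotations would not be antisymmetric. \<open>None\<close> is the narrowest element,
  and \<open>W\<close> holds the nodes whose coordinates may change.\<close>

definition narrows :: "nat set \<Rightarrow> lat \<Rightarrow> lat \<Rightarrow> bool" where
  "narrows W X Y = (\<forall>L' U'. Y = Some (L', U') \<longrightarrow> (\<exists>L U. X = Some (L, U) \<and> L \<le> L' \<and> U' \<le> U \<and>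
     (\<forall>v. v \<notin> W \<longrightarrow> L' v = L v \<and> U' v = U v)))"

lemma narrows_refl: "narrows W X X"
  by (auto simp: narrows_def)

lemma narrows_trans: "narrows W X Y \<Longrightarrow> narrows W Y Z \<Longrightarrow> narrows W X Z"
  by (cases X; cases Y; cases Z) (force simp: narrows_def intro: order_trans)+

lemma narrows_antisym: "narrows W X Y \<Longrightarrow> narrows W Y X \<Longrightarrow> X = Y"
  by (cases X; cases Y) (auto simp: narrows_def)

text \<open>\<open>g\<close> is \<open>Some\<close> for iterations on pairs of bounds and the
  identity for iterations on lattices.\<close>

lemma narrows_order:
  assumes "inj g"
  shows "reflp (\<lambda>x y. narrows W (g x) (g y))" "transp (\<lambda>x y. narrows W (g x) (g y))"
    "antisymp (\<lambda>x y. narrows W (g x) (g y))"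
proof -
  show "reflp (\<lambda>x y. narrows W (g x) (g y))" by (rule reflpI) (rule narrows_refl)
  show "transp (\<lambda>x y. narrows W (g x) (g y))" by (rule transpI) (rule narrows_trans)
  show "antisymp (\<lambda>x y. narrows W (g x) (g y))"
    by (rule antisympI, rule injD[OF assms]) (rule narrows_antisym)
qed

lemma narrows_weaken: "narrows V X Y \<Longrightarrow> V \<subseteq> W \<Longrightarrow> narrows W X Y"
  by (fastforce simp: narrows_def)

lemma narrows_None: "narrows W X None"
  by (simp add: narrows_def)

lemma denote_narrows: "narrows W X Y \<Longrightarrow> denote n I m Y \<subseteq> denote n I m X"
  by (cases Y) (fastforce simp: narrows_def denote_def ple_def le_fun_def intro: order_trans)+

text \<open>The finite carrier of all iterations. Pairs with \<open>L\<close> not below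
  \<open>U\<close> belong to it, as narrowing may produce them.\<close>

definition lats :: "nat \<Rightarrow> (nat \<times> nat) set \<Rightarrow> (nat \<Rightarrow> nat) \<Rightarrow> lat set" where
  "lats n I m = insert None (Some ` (Params n I m \<times> Params n I m))"

lemma lats_simps [simp]:
  "None \<in> lats n I m"
  "Some (L, U) \<in> lats n I m \<longleftrightarrow> L \<in> Params n I m \<and> U \<in> Params n I m"
  by (auto simp: lats_def)

lemma finite_lats: "finite I \<Longrightarrow> finite (lats n I m)"
  by (simp add: lats_def finite_Params)

section \<open>Sign constraints and their narrowing step\<close>

lemma Omega_v_update:
  "\<omega> \<in> Omega_v I m v \<Longrightarrow> u \<in> regs I v \<Longrightarrow> k \<le> m u \<Longrightarrow> \<omega>(u := k) \<in> Omega_v I m v"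
  by (auto simp: Omega_v_def)

lemma Omega_v_le: "\<omega> \<in> Omega_v I m v \<Longrightarrow> u \<in> regs I v \<Longrightarrow> \<omega> u \<le> m u"
  by (auto simp: Omega_v_def)

text \<open>Treats both signs at once, in the terms of \<open>sgn_step\<close>:
  \<open>\<omega> u - s\<close> is the neighbouring value at which \<open>P\<close> must not be
  larger.\<close>

definition sgn_mono :: "(nat \<times> nat) set \<Rightarrow> (nat \<Rightarrow> nat) \<Rightarrow> nat \<Rightarrow> nat \<Rightarrow> int \<Rightarrow> par \<Rightarrow> bool" where
  "sgn_mono I m u v s P = (\<forall>\<omega>\<in>Omega_v I m v. 0 \<le> int (\<omega> u) - s \<longrightarrow> int (\<omega> u) - s \<le> int (m u)
     \<longrightarrow> P v (\<omega>(u := nat (int (\<omega> u) - s))) \<le> P v \<omega>)"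

text \<open>Reindexing by a shift of \<open>u\<close> by \<open>s\<close>: the backward form matches
  the update of \<open>L\<close> in \<open>sgn_step\<close>, the forward form that of
  \<open>U\<close>.\<close>

lemma sgn_mono_forward:
  assumes "u \<in> regs I v"
  shows "sgn_mono I m u v s P \<longleftrightarrow> (\<forall>\<omega>\<in>Omega_v I m v. 0 \<le> int (\<omega> u) + s \<longrightarrow> int (\<omega> u) + s \<le> int (m u)
     \<longrightarrow> P v \<omega> \<le> P v (\<omega>(u := nat (int (\<omega> u) + s))))" (is "_ \<longleftrightarrow> ?R")
proof
  assume l: "sgn_mono I m u v s P"
  show ?R
  proof (intro ballI impI)
    fix \<omega> assume \<omega>: "\<omega> \<in> Omega_v I m v" "0 \<le> int (\<omega> u) + s" "int (\<omega> u) + s \<le> int (m u)"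
    let ?w = "\<omega>(u := nat (int (\<omega> u) + s))"
    have w: "?w \<in> Omega_v I m v" using \<omega> assms by (intro Omega_v_update) auto
    have s: "int (?w u) - s = int (\<omega> u)" using \<omega>(2) by simp
    have "P v (?w(u := nat (int (?w u) - s))) \<le> P v ?w"
      using l w Omega_v_le[OF \<omega>(1) assms] s unfolding sgn_mono_def
      by (metis of_nat_0_le_iff of_nat_le_iff)
    then show "P v \<omega> \<le> P v ?w" unfolding s by simp
  qed
next
  assume r: ?R
  show "sgn_mono I m u v s P"
    unfolding sgn_mono_def
  proof (intro ballI impI)
    fix \<omega> assume \<omega>: "\<omega> \<in> Omega_v I m v" "0 \<le> int (\<omega> u) - s" "int (\<omega> u) - s \<le> int (m u)"
    let ?w = "\<omega>(u := nat (int (\<omega> u) - s))"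
    have w: "?w \<in> Omega_v I m v" using \<omega> assms by (intro Omega_v_update) auto
    have s: "int (?w u) + s = int (\<omega> u)" using \<omega>(2) by simp
    have "P v ?w \<le> P v (?w(u := nat (int (?w u) + s)))"
      using r w Omega_v_le[OF \<omega>(1) assms] s by (metis of_nat_0_le_iff of_nat_le_iff)
    then show "P v ?w \<le> P v \<omega>" unfolding s by simp
  qed
qed

lemma sgn_mono_Pos:
  assumes "u \<in> regs I v"
  shows "sgn_mono I m u v 1 P \<longleftrightarrow> P \<in> Pcon I m (u, v, Pos)"
proof
  assume l: "sgn_mono I m u v 1 P"
  have "P v (\<omega>(u := x - 1)) \<le> P v (\<omega>(u := x))"
    if "\<omega> \<in> Omega_v I m v" "x \<in> {1..m u}" for \<omega> x
  proof -
    have "\<omega>(u := x) \<in> Omega_v I m v" using that assms by (intro Omega_v_update) auto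
    then show ?thesis using l that unfolding sgn_mono_def by (force simp: nat_diff_distrib)
  qed
  then show "P \<in> Pcon I m (u, v, Pos)" by auto
next
  assume r: "P \<in> Pcon I m (u, v, Pos)"
  show "sgn_mono I m u v 1 P"
    unfolding sgn_mono_def
  proof (intro ballI impI)
    fix \<omega> assume \<omega>: "\<omega> \<in> Omega_v I m v" "0 \<le> int (\<omega> u) - 1" "int (\<omega> u) - 1 \<le> int (m u)"
    have "\<omega> u \<in> {1..m u}" using \<omega> Omega_v_le[OF \<omega>(1) assms] by auto
    then have "P v (\<omega>(u := \<omega> u - 1)) \<le> P v (\<omega>(u := \<omega> u))" using r \<omega>(1) unfolding Pcon.simps by blast
    then show "P v (\<omega>(u := nat (int (\<omega> u) - 1))) \<le> P v \<omega>" by (simp add: nat_diff_distrib')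
  qed
qed

lemma sgn_mono_Neg:
  assumes "u \<in> regs I v"
  shows "sgn_mono I m u v (-1) P \<longleftrightarrow> P \<in> Pcon I m (u, v, Neg)"
proof
  assume l: "sgn_mono I m u v (-1) P"
  have "P v (\<omega>(u := x)) \<le> P v (\<omega>(u := x - 1))"
    if "\<omega> \<in> Omega_v I m v" "x \<in> {1..m u}" for \<omega> x
  proof -
    \<comment> \<open>With \<open>s = -1\<close> the neighbour of a state lies one above it, so the
      hypothesis is used at \<open>x - 1\<close>.\<close>
    let ?w = "\<omega>(u := x - 1)"
    have w: "?w \<in> Omega_v I m v" using that assms by (intro Omega_v_update) auto
    have "int (?w u) - -1 = int x" using that by auto
    then have "P v (?w(u := nat (int x))) \<le> P v ?w"
      using l w that unfolding sgn_mono_def by (metis atLeastAtMost_iff of_nat_0_le_iff of_nat_le_iff)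
    then show ?thesis by simp
  qed
  then show "P \<in> Pcon I m (u, v, Neg)" by auto
next
  assume r: "P \<in> Pcon I m (u, v, Neg)"
  show "sgn_mono I m u v (-1) P"
    unfolding sgn_mono_def
  proof (intro ballI impI)
    fix \<omega> assume \<omega>: "\<omega> \<in> Omega_v I m v" "0 \<le> int (\<omega> u) - -1" "int (\<omega> u) - -1 \<le> int (m u)"
    have "Suc (\<omega> u) \<in> {1..m u}" using \<omega> by auto
    then have "P v (\<omega>(u := Suc (\<omega> u))) \<le> P v (\<omega>(u := Suc (\<omega> u) - 1))"
      using r \<omega>(1) unfolding Pcon.simps by blast
    moreover have "nat (int (\<omega> u) - -1) = Suc (\<omega> u)" by simp
    ultimately show "P v (\<omega>(u := nat (int (\<omega> u) - -1))) \<le> P v \<omega>" by simp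
  qed
qed

lemma Max_Min_insert_if:
  fixes a b :: "'a :: linorder"
  shows "Max ({a} \<union> (if c then {b} else {})) = (if c then max a b else a)"
    "Min ({a} \<union> (if c then {b} else {})) = (if c then min a b else a)"
  by simp_all

lemma sgn_step_eq:
  "sgn_step I m u v s (L, U) =
     ((\<lambda>v' \<omega>. if v' = v \<and> \<omega> \<in> Omega_v I m v \<and> 0 \<le> int (\<omega> u) - s \<and> int (\<omega> u) - s \<le> int (m u)
         then max (L v \<omega>) (L v (\<omega>(u := nat (int (\<omega> u) - s)))) else L v' \<omega>),
      (\<lambda>v' \<omega>. if v' = v \<and> \<omega> \<in> Omega_v I m v \<and> 0 \<le> int (\<omega> u) + s \<and> int (\<omega> u) + s \<le> int (m u)
         then min (U v \<omega>) (U v (\<omega>(u := nat (int (\<omega> u) + s)))) else U v' \<omega>))"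
  unfolding sgn_step_def Let_def fst_conv snd_conv Max_Min_insert_if by (intro prod_eqI ext) simp_all

text \<open>When \<open>max\<close> and \<open>min\<close> return their first argument, the second
  one satisfies the required inequality: the backward form for \<open>L\<close>, the forward form
  for \<open>U\<close>.\<close>

lemma sgn_step_fixed:
  assumes "u \<in> regs I v" "sgn_step I m u v s (L, U) = (L, U)"
  shows "sgn_mono I m u v s L" "sgn_mono I m u v s U"
proof -
  have L: "(if v' = v \<and> \<omega> \<in> Omega_v I m v \<and> 0 \<le> int (\<omega> u) - s \<and> int (\<omega> u) - s \<le> int (m u)
         then max (L v \<omega>) (L v (\<omega>(u := nat (int (\<omega> u) - s)))) else L v' \<omega>) = L v' \<omega>" for v' \<omega>
    using assms(2) unfolding sgn_step_eq prod.inject fun_eq_iff by blast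
  have U: "(if v' = v \<and> \<omega> \<in> Omega_v I m v \<and> 0 \<le> int (\<omega> u) + s \<and> int (\<omega> u) + s \<le> int (m u)
         then min (U v \<omega>) (U v (\<omega>(u := nat (int (\<omega> u) + s)))) else U v' \<omega>) = U v' \<omega>" for v' \<omega>
    using assms(2) unfolding sgn_step_eq prod.inject fun_eq_iff by blast
  show "sgn_mono I m u v s L" unfolding sgn_mono_def
    using L[of v] by (metis max.cobounded2)
  show "sgn_mono I m u v s U" unfolding sgn_mono_forward[OF assms(1)]
    using U[of v] by (metis min.cobounded2)
qed

lemma sgn_step_narrows: "narrows {v} (Some LU) (Some (sgn_step I m u v s LU))"
  by (cases LU) (auto simp: narrows_def sgn_step_eq le_fun_def)

lemma sgn_step_Params:
  assumes "v < n" "LU \<in> Params n I m \<times> Params n I m"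
  shows "sgn_step I m u v s LU \<in> Params n I m \<times> Params n I m"
proof -
  obtain L U where LU: "LU = (L, U)" "L \<in> Params n I m" "U \<in> Params n I m" using assms by auto
  have "L v \<omega> = 0" "U v \<omega> = 0" if "\<not> (v < n \<and> \<omega> \<in> Omega_v I m v)" for v \<omega>
    using that LU Params_outside by blast+
  then show ?thesis unfolding LU(1) sgn_step_eq mem_Times_iff fst_conv snd_conv
    using Params_le[OF LU(2)] Params_le[OF LU(3)] assms(1)
    by (intro conjI ParamsI) (auto simp only: split: if_splits, simp_all add: min_le_iff_disj)
qed

lemma sgn_step_sound:
  assumes "v < n" "u \<in> regs I v" "sgn_mono I m u v s P" "P \<in> denote n I m (Some LU)"
  shows "P \<in> denote n I m (Some (sgn_step I m u v s LU))"
proof -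
  obtain L U where LU: "LU = (L, U)" by (cases LU)
  have P: "P \<in> Params n I m" "\<And>v \<omega>. v < n \<Longrightarrow> \<omega> \<in> Omega_v I m v \<Longrightarrow> L v \<omega> \<le> P v \<omega>"
    "\<And>v \<omega>. v < n \<Longrightarrow> \<omega> \<in> Omega_v I m v \<Longrightarrow> P v \<omega> \<le> U v \<omega>"
    using assms(4) by (auto simp: LU denote_def ple_def)
  have "L v (\<omega>(u := nat (int (\<omega> u) - s))) \<le> P v \<omega>"
    if "\<omega> \<in> Omega_v I m v" "0 \<le> int (\<omega> u) - s" "int (\<omega> u) - s \<le> int (m u)" for \<omega>
    using that P(2)[OF assms(1) Omega_v_update[OF that(1) assms(2), of "nat (int (\<omega> u) - s)"]] assms(3)
    unfolding sgn_mono_def by (meson nat_le_iff order_trans)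
  moreover have "P v \<omega> \<le> U v (\<omega>(u := nat (int (\<omega> u) + s)))"
    if "\<omega> \<in> Omega_v I m v" "0 \<le> int (\<omega> u) + s" "int (\<omega> u) + s \<le> int (m u)" for \<omega>
    using that P(3)[OF assms(1) Omega_v_update[OF that(1) assms(2), of "nat (int (\<omega> u) + s)"]] assms(3)
    unfolding sgn_mono_forward[OF assms(2)] by (meson nat_le_iff order_trans)
  ultimately show ?thesis using P by (auto simp: LU sgn_step_eq denote_def ple_def)
qed

lemma fixp_sgn_step:
  fixes s :: int
  assumes "finite I" "v < n" "u \<in> regs I v" "L \<in> Params n I m" "U \<in> Params n I m"
  defines "F \<equiv> fixp (sgn_step I m u v s) (L, U)"
  shows "sgn_step I m u v s F = F" "F \<in> Params n I m \<times> Params n I m" "narrows {v} (Some (L, U)) (Some F)"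
proof -
  have fin: "finite (Params n I m \<times> Params n I m)" using assms finite_Params by blast
  have step: "sgn_step I m u v s LU \<in> Params n I m \<times> Params n I m \<and>
      narrows {v} (Some LU) (Some (sgn_step I m u v s LU))" if "LU \<in> Params n I m \<times> Params n I m" for LU
    using sgn_step_Params[OF assms(2) that] sgn_step_narrows by blast
  have LU: "(L, U) \<in> Params n I m \<times> Params n I m" using assms(4,5) by simp
  note * = fixp_decreasing[OF narrows_order[OF inj_Some] fin LU step]
  show "sgn_step I m u v s F = F" "F \<in> Params n I m \<times> Params n I m" "narrows {v} (Some (L, U)) (Some F)"
    unfolding F_def by (rule *; assumption)+
qed

section \<open>Constraints of a network, separated by node\<close>

locale influence_constraints =
  fixes n :: nat and I :: "(nat \<times> nat) set" and m :: "nat \<Rightarrow> nat" and R :: "(nat \<times> nat \<times> sgn) set"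
  assumes I: "I \<subseteq> {..<n} \<times> {..<n}" and wf: "wf_constraints I R"
begin

lemma finite_I: "finite I"
  using I by (rule finite_subset) simp

lemma constraintD: "(u, v, c) \<in> R \<Longrightarrow> u \<in> regs I v \<and> v < n"
  using wf I by (auto simp: wf_constraints_def regs_def)

sublocale regulator_order "Omega_v I m v" "prec I R v" m "regs I v" for v
proof
  show "finite (Omega_v I m v)" by (rule finite_Omega_v[OF finite_I])
  show "\<omega>(u := k) \<in> Omega_v I m v" if "\<omega> \<in> Omega_v I m v" "u \<in> regs I v" "k \<le> m u" for \<omega> u k
    using that by (rule Omega_v_update)
  show "\<omega> u \<le> m u" if "\<omega> \<in> Omega_v I m v" "u \<in> regs I v" for \<omega> u
    using that by (rule Omega_v_le)
  show "prec I R v a a" for a by (simp add: prec_def)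
  show "prec I R v a c" if "prec I R v a b" "prec I R v b c" for a b c
    using that unfolding prec_def by (smt (verit) order_trans)
  show "a = b" if "a \<in> Omega_v I m v" "b \<in> Omega_v I m v" "prec I R v a b" "prec I R v b a" for a b
  proof
    fix u
    show "a u = b u"
    proof (cases "u \<in> regs I v")
      case True
      then show ?thesis using that(3,4) unfolding prec_def by (metis order_antisym)
    next
      case False
      \<comment> \<open>\<open>prec\<close> looks at regulators only; elsewhere both states are
        0.\<close>
      then show ?thesis using that(1,2) by (simp add: Omega_v_def)
    qed
  qed
qed

text \<open>The constraints compare states one unit apart in one regulator. Units are joined to
  intervals, and \<open>a\<close> is turned into \<open>b\<close> one regulator at a time through
  the states \<open>mix S\<close>; at a regulator without sign, \<open>prec\<close> already gives
  equal values.\<close>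

lemma monotone_on_prec:
  assumes "\<And>u c. (u, v, c) \<in> R \<Longrightarrow> c \<noteq> Obs \<Longrightarrow> P \<in> Pcon I m (u, v, c)"
  shows "monotone_on (Omega_v I m v) (prec I R v) (\<le>) (P v)"
  unfolding monotone_on_def
proof (intro ballI impI)
  fix a b assume ab: "a \<in> Omega_v I m v" "b \<in> Omega_v I m v" "prec I R v a b"
  have pos: "P v (\<omega>(u := k)) \<le> P v (\<omega>(u := l))"
    if "(u, v, Pos) \<in> R" "\<omega> \<in> Omega_v I m v" "k \<le> l" "l \<le> m u" for u \<omega> k l
    using that(3,4)
  proof (induction l rule: dec_induct)
    case (step l)
    have "Suc l \<in> {1..m u}" using step.prems by auto
    then have "P v (\<omega>(u := Suc l - 1)) \<le> P v (\<omega>(u := Suc l))"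
      using assms[OF that(1)] that(2) unfolding Pcon.simps by blast
    then show ?case using step by (metis Suc_leD diff_Suc_1 order_trans)
  qed simp
  have neg: "P v (\<omega>(u := l)) \<le> P v (\<omega>(u := k))"
    if "(u, v, Neg) \<in> R" "\<omega> \<in> Omega_v I m v" "k \<le> l" "l \<le> m u" for u \<omega> k l
    using that(3,4)
  proof (induction l rule: dec_induct)
    case (step l)
    have "Suc l \<in> {1..m u}" using step.prems by auto
    then have "P v (\<omega>(u := Suc l)) \<le> P v (\<omega>(u := Suc l - 1))"
      using assms[OF that(1)] that(2) unfolding Pcon.simps by blast
    then show ?case using step by (metis Suc_leD diff_Suc_1 order_trans)
  qed simp
  define mix where "mix S = (\<lambda>u. if u \<in> S then b u else a u)" for S
  have mix: "mix S \<in> Omega_v I m v" for S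
    using ab by (auto simp: mix_def Omega_v_def)
  have "finite S \<Longrightarrow> S \<subseteq> regs I v \<Longrightarrow> P v a \<le> P v (mix S)" for S
  proof (induction S rule: finite_induct)
    case empty
    then show ?case by (simp add: mix_def)
  next
    case (insert u S)
    have u: "u \<in> regs I v" using insert by simp
    have eq: "mix S = (mix S)(u := a u)" "mix (insert u S) = (mix S)(u := b u)"
      using insert(2) by (auto simp: mix_def fun_eq_iff)
    have le: "a u \<le> m u" "b u \<le> m u" using ab u by (auto simp: Omega_v_def)
    have "if (u, v, Pos) \<in> R then a u \<le> b u else if (u, v, Neg) \<in> R then a u \<ge> b u else a u = b u"
      using ab(3) u by (simp add: prec_def)
    then have "P v ((mix S)(u := a u)) \<le> P v ((mix S)(u := b u))"
      using pos[OF _ mix _ le(2)] neg[OF _ mix _ le(1)] by (auto split: if_splits)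
    then show ?case using insert eq by (metis insert_subset order_trans)
  qed
  from this[of "regs I v"] have "P v a \<le> P v (mix (regs I v))"
    using finite_regs[OF finite_I] by simp
  moreover have "mix (regs I v) = b" using ab by (auto simp: mix_def Omega_v_def fun_eq_iff)
  ultimately show "P v a \<le> P v b" by simp
qed

text \<open>The constraints split by target node: those on \<open>v\<close> concern only the
  function \<open>P v\<close>. This independence later allows functions at different nodes to be
  glued together.\<close>

definition admissible :: "nat \<Rightarrow> (rstate \<Rightarrow> nat) \<Rightarrow> bool" where
  "admissible v h \<longleftrightarrow> monotone_on (Omega_v I m v) (prec I R v) (\<le>) h
     \<and> (\<forall>u. (u, v, Obs) \<in> R \<longrightarrow> depends (Omega_v I m v) m u h)"

lemma Pcon_Obs: "P \<in> Pcon I m (u, v, Obs) \<longleftrightarrow> depends (Omega_v I m v) m u (P v)"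
  by (simp add: depends_def)

lemma Pcon_iff_admissible: "(\<forall>r\<in>R. P \<in> Pcon I m r) \<longleftrightarrow> (\<forall>v. admissible v (P v))"
proof
  assume l: "\<forall>r\<in>R. P \<in> Pcon I m r"
  then show "\<forall>v. admissible v (P v)"
    unfolding admissible_def using monotone_on_prec Pcon_Obs by blast
next
  assume r: "\<forall>v. admissible v (P v)"
  have "P \<in> Pcon I m (u, v, c)" if uvc: "(u, v, c) \<in> R" for u v c
  proof -
    have u: "u \<in> regs I v" using constraintD[OF uvc] by simp
    have step: "P v a \<le> P v b" if "a \<in> Omega_v I m v" "b \<in> Omega_v I m v" "prec I R v a b" for a b
      using r that unfolding admissible_def monotone_on_def by blast
    have upd': "\<omega>(u := x) \<in> Omega_v I m v" "\<omega>(u := x - 1) \<in> Omega_v I m v"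
      if "\<omega> \<in> Omega_v I m v" "x \<in> {1..m u}" for \<omega> x
      using that u Omega_v_update by auto
    show ?thesis
    proof (cases c)
      case Pos
      have "P v (\<omega>(u := x - 1)) \<le> P v (\<omega>(u := x))" if "\<omega> \<in> Omega_v I m v" "x \<in> {1..m u}" for \<omega> x
        using uvc Pos that by (intro step upd') (auto simp: prec_def)
      then show ?thesis using Pos by simp
    next
      case Neg
      \<comment> \<open>\<open>prec\<close> tests the positive sign first; well-formedness ensures
        that its negative branch is reached.\<close>
      have "(u, v, Pos) \<notin> R" using uvc Neg wf by (auto simp: wf_constraints_def)
      then have "P v (\<omega>(u := x)) \<le> P v (\<omega>(u := x - 1))" if "\<omega> \<in> Omega_v I m v" "x \<in> {1..m u}" for \<omega> x
        using uvc Neg that by (intro step upd') (auto simp: prec_def)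
      then show ?thesis using Neg by simp
    next
      case Obs
      then show ?thesis using r uvc unfolding admissible_def Obs Pcon_Obs by blast
    qed
  qed
  then show "\<forall>r\<in>R. P \<in> Pcon I m r" by auto
qed

lemma Aset_eq_varies:
  "Aset I m u v L U = varies (Omega_v I m v) m u (\<lambda>\<omega>. int (L v \<omega>)) (\<lambda>\<omega>. int (U v \<omega>))"
  by (simp add: Aset_def varies_def)

text \<open>Negation turns each strict inequality around, which exchanges the two disjuncts.\<close>

lemma Aset_eq_varies_dual:
  "Aset I m u v L U = varies (Omega_v I m v) m u (\<lambda>\<omega>. - int (U v \<omega>)) (\<lambda>\<omega>. - int (L v \<omega>))"
  unfolding Aset_def varies_def by (simp add: disj_commute)

lemma Bover_eq_peaks:
  "Bover I R v A L U = peaks (prec I R v) A (\<lambda>\<omega>. int (L v \<omega>)) (\<lambda>\<omega>. int (U v \<omega>))"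
  by (auto simp: Bover_def peaks_def incomp_def)

lemma Bunder_eq_peaks:
  "Bunder I R v A L U = peaks (\<lambda>a b. prec I R v b a) A (\<lambda>\<omega>. - int (U v \<omega>)) (\<lambda>\<omega>. - int (L v \<omega>))"
  by (auto simp: Bunder_def peaks_def incomp_def)

section \<open>Stable bounds are attained\<close>

text \<open>What a fixpoint of all narrowings on \<open>v\<close> says about \<open>L v\<close> and
  \<open>U v\<close> alone: a singleton \<open>Bover\<close> or \<open>Bunder\<close> would still
  move a bound. It does not include \<open>L \<le> U\<close>.\<close>

definition stable :: "nat \<Rightarrow> par \<Rightarrow> par \<Rightarrow> bool" where
  "stable v L U \<longleftrightarrow> (\<forall>u c. (u, v, c) \<in> R \<longrightarrow>
     (if c = Obs then let A = Aset I m u v L U in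
        A \<noteq> {} \<and> (\<nexists>\<omega>. Bover I R v A L U = {\<omega>}) \<and> (\<nexists>\<omega>. Bunder I R v A L U = {\<omega>})
      else L \<in> Pcon I m (u, v, c) \<and> U \<in> Pcon I m (u, v, c)))"

text \<open>Carries stability over to nodes that a later narrowing leaves untouched.\<close>

lemma stable_cong:
  assumes "L v = L' v" "U v = U' v"
  shows "stable v L U \<longleftrightarrow> stable v L' U'"
proof -
  have "P \<in> Pcon I m (u, v, c) \<longleftrightarrow> P' \<in> Pcon I m (u, v, c)" if "P v = P' v" for P P' :: par and u c
    using that by (cases c) auto
  then have "L \<in> Pcon I m (u, v, c) \<longleftrightarrow> L' \<in> Pcon I m (u, v, c)"
    "U \<in> Pcon I m (u, v, c) \<longleftrightarrow> U' \<in> Pcon I m (u, v, c)" for u c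
    using assms by blast+
  moreover have "Aset I m u v L U = Aset I m u v L' U'" for u
    using assms by (simp add: Aset_def)
  moreover have "Bover I R v A L U = Bover I R v A L' U'" "Bunder I R v A L U = Bunder I R v A L' U'" for A
    using assms by (simp_all add: Bover_def Bunder_def)
  ultimately show ?thesis unfolding stable_def by simp
qed

text \<open>Two uses of \<open>lower_bound_attained\<close>: with the bounds as integers, and with
  the bounds negated and exchanged under the reversed order. The integer functions found are then
  turned back into naturals.\<close>

lemma stable_bounds_attained:
  assumes st: "stable v L U" and p: "p \<in> Omega_v I m v"
    and box: "\<And>\<omega>. \<omega> \<in> Omega_v I m v \<Longrightarrow> L v \<omega> \<le> U v \<omega>"
  shows "\<exists>h. admissible v h \<and> (\<forall>\<omega>\<in>Omega_v I m v. L v \<omega> \<le> h \<omega> \<and> h \<omega> \<le> U v \<omega>) \<and> h p = L v p"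
    and "\<exists>h. admissible v h \<and> (\<forall>\<omega>\<in>Omega_v I m v. L v \<omega> \<le> h \<omega> \<and> h \<omega> \<le> U v \<omega>) \<and> h p = U v p"
proof -
  let ?\<Omega> = "Omega_v I m v" and ?S = "{u. (u, v, Obs) \<in> R}"
  let ?L = "\<lambda>\<omega>. int (L v \<omega>)" and ?U = "\<lambda>\<omega>. int (U v \<omega>)"
  let ?L' = "\<lambda>\<omega>. - int (U v \<omega>)" and ?U' = "\<lambda>\<omega>. - int (L v \<omega>)"
  have S: "?S \<subseteq> regs I v" using constraintD by blast
  have con: "L \<in> Pcon I m (u, v, c)" "U \<in> Pcon I m (u, v, c)" if "(u, v, c) \<in> R" "c \<noteq> Obs" for u c
    using st that unfolding stable_def by (metis (full_types))+
  have obs: "Aset I m u v L U \<noteq> {}" "Bover I R v (Aset I m u v L U) L U \<noteq> {p}"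
    "Bunder I R v (Aset I m u v L U) L U \<noteq> {p}" if "u \<in> ?S" for u
  proof -
    have "(u, v, Obs) \<in> R" using that by simp
    from st[unfolded stable_def, rule_format, OF this]
    show "Aset I m u v L U \<noteq> {}" "Bover I R v (Aset I m u v L U) L U \<noteq> {p}"
      "Bunder I R v (Aset I m u v L U) L U \<noteq> {p}" by (auto simp only: Let_def if_True simp_thms)
  qed
  have L: "monotone_on ?\<Omega> (prec I R v) (\<le>) (L v)" by (rule monotone_on_prec) (rule con)
  have U: "monotone_on ?\<Omega> (prec I R v) (\<le>) (U v)" by (rule monotone_on_prec) (rule con)
  have "\<exists>f. monotone_on ?\<Omega> (prec I R v) (\<le>) f \<and> (\<forall>\<omega>\<in>?\<Omega>. ?L \<omega> \<le> f \<omega> \<and> f \<omega> \<le> ?U \<omega>) \<and> f p = ?L p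
    \<and> (\<forall>u\<in>?S. depends ?\<Omega> m u f)"
    using L U box obs(1,2)
    by (intro lower_bound_attained S p) (auto simp: monotone_on_def Aset_eq_varies Bover_eq_peaks)
  then obtain f where f: "monotone_on ?\<Omega> (prec I R v) (\<le>) f" "\<forall>\<omega>\<in>?\<Omega>. ?L \<omega> \<le> f \<omega> \<and> f \<omega> \<le> ?U \<omega>"
    "f p = ?L p" "\<forall>u\<in>?S. depends ?\<Omega> m u f" by blast
  interpret dual: regulator_order ?\<Omega> "\<lambda>a b. prec I R v b a" m "regs I v" by (rule dual)
  have "\<exists>f. monotone_on ?\<Omega> (\<lambda>a b. prec I R v b a) (\<le>) f \<and> (\<forall>\<omega>\<in>?\<Omega>. ?L' \<omega> \<le> f \<omega> \<and> f \<omega> \<le> ?U' \<omega>)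
    \<and> f p = ?L' p \<and> (\<forall>u\<in>?S. depends ?\<Omega> m u f)"
    using L U box obs(1,3)
    by (intro dual.lower_bound_attained S p) (auto simp: monotone_on_def Aset_eq_varies_dual Bunder_eq_peaks)
  then obtain g where g: "monotone_on ?\<Omega> (\<lambda>a b. prec I R v b a) (\<le>) g"
    "\<forall>\<omega>\<in>?\<Omega>. ?L' \<omega> \<le> g \<omega> \<and> g \<omega> \<le> ?U' \<omega>" "g p = ?L' p" "\<forall>u\<in>?S. depends ?\<Omega> m u g" by blast
  \<comment> \<open>Dependence only asks for two different values, so it passes to any
    \<open>h'\<close> that separates at least the states separated by \<open>h\<close>.\<close>
  have dep: "depends ?\<Omega> m u h'" if h: "u \<in> ?S" "depends ?\<Omega> m u h"
    "\<And>a b. a \<in> ?\<Omega> \<Longrightarrow> b \<in> ?\<Omega> \<Longrightarrow> h a \<noteq> h b \<Longrightarrow> h' a \<noteq> h' b" for u and h :: "rstate \<Rightarrow> int" and h' :: "rstate \<Rightarrow> nat"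
  proof -
    obtain \<omega> x where \<omega>: "\<omega> \<in> ?\<Omega>" "x \<in> {1..m u}" "h (\<omega>(u := x)) \<noteq> h (\<omega>(u := x - 1))"
      using h(2) unfolding depends_def by blast
    have u: "u \<in> regs I v" using h(1) S by blast
    have "\<omega>(u := x) \<in> ?\<Omega>" "\<omega>(u := x - 1) \<in> ?\<Omega>" using \<omega> u upd by auto
    then show ?thesis using \<omega> h(3) unfolding depends_def by blast
  qed
  \<comment> \<open>\<open>nat\<close> merges only values that are not positive; \<open>f\<close>
    lies above a natural bound, so no distinct values are merged. The same holds below for
    \<open>- g\<close>, as \<open>g\<close> lies below \<open>- L\<close>.\<close>
  have f0: "0 \<le> f \<omega>" if "\<omega> \<in> ?\<Omega>" for \<omega> using f(2) that by force
  have "depends ?\<Omega> m u (\<lambda>\<omega>. nat (f \<omega>))" if "(u, v, Obs) \<in> R" for u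
  proof (rule dep)
    show "u \<in> ?S" "depends ?\<Omega> m u f" using that f(4) by auto
    show "nat (f a) \<noteq> nat (f b)" if "a \<in> ?\<Omega>" "b \<in> ?\<Omega>" "f a \<noteq> f b" for a b
      using that f0[of a] f0[of b] by simp
  qed
  then have "admissible v (\<lambda>\<omega>. nat (f \<omega>))"
    unfolding admissible_def using f(1) by (auto simp: monotone_on_def intro!: nat_mono)
  then show "\<exists>h. admissible v h \<and> (\<forall>\<omega>\<in>?\<Omega>. L v \<omega> \<le> h \<omega> \<and> h \<omega> \<le> U v \<omega>) \<and> h p = L v p"
    using f(2,3) by (intro exI[of _ "\<lambda>\<omega>. nat (f \<omega>)"]) (auto simp: nat_le_iff le_nat_iff f0)
  have g0: "g \<omega> \<le> 0" if "\<omega> \<in> ?\<Omega>" for \<omega> using g(2) that by force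
  have "depends ?\<Omega> m u (\<lambda>\<omega>. nat (- g \<omega>))" if "(u, v, Obs) \<in> R" for u
  proof (rule dep)
    show "u \<in> ?S" "depends ?\<Omega> m u g" using that g(4) by auto
    show "nat (- g a) \<noteq> nat (- g b)" if "a \<in> ?\<Omega>" "b \<in> ?\<Omega>" "g a \<noteq> g b" for a b
      using that g0[of a] g0[of b] by simp
  qed
  then have "admissible v (\<lambda>\<omega>. nat (- g \<omega>))"
    unfolding admissible_def using g(1) by (auto simp: monotone_on_def intro!: nat_mono)
  then show "\<exists>h. admissible v h \<and> (\<forall>\<omega>\<in>?\<Omega>. L v \<omega> \<le> h \<omega> \<and> h \<omega> \<le> U v \<omega>) \<and> h p = U v p"
    using g(2,3) g0 by (intro exI[of _ "\<lambda>\<omega>. nat (- g \<omega>)"]) (force simp: nat_le_iff le_nat_iff)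
qed

section \<open>Correctness of the narrowing operator of a single constraint\<close>

lemma depends_int: "depends \<Omega> k u (\<lambda>\<omega>. int (f \<omega>)) \<longleftrightarrow> depends \<Omega> k u f"
  "depends \<Omega> k u (\<lambda>\<omega>. - int (f \<omega>)) \<longleftrightarrow> depends \<Omega> k u f"
  by (simp_all add: depends_def)

definition models :: "par set" where
  "models = {P \<in> Params n I m. \<forall>r\<in>R. P \<in> Pcon I m r}"

text \<open>The first two facts serve the termination of the composed iteration, the third its
  soundness and the fourth its tightness.\<close>

lemma nabla_sign_correct:
  assumes uv: "u \<in> regs I v" "v < n" and X: "X \<in> lats n I m"
  shows "nabla_sign I m u v s X \<in> lats n I m" "narrows {v} X (nabla_sign I m u v s X)"
    and "sgn_mono I m u v s P \<Longrightarrow> P \<in> denote n I m X \<Longrightarrow> P \<in> denote n I m (nabla_sign I m u v s X)"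
    and "nabla_sign I m u v s X = X \<Longrightarrow> X = Some (L, U) \<Longrightarrow> sgn_mono I m u v s L \<and> sgn_mono I m u v s U"
proof -
  have "nabla_sign I m u v s X \<in> lats n I m \<and> narrows {v} X (nabla_sign I m u v s X)
    \<and> (sgn_mono I m u v s P \<longrightarrow> P \<in> denote n I m X \<longrightarrow> P \<in> denote n I m (nabla_sign I m u v s X))
    \<and> (nabla_sign I m u v s X = X \<longrightarrow> X = Some (L, U) \<longrightarrow> sgn_mono I m u v s L \<and> sgn_mono I m u v s U)"
  proof (cases X)
    case None
    then show ?thesis by (simp add: nabla_sign_def narrows_None)
  next
    case (Some LU)
    obtain L' U' where LU: "LU = (L', U')" by (cases LU)
    have LU': "L' \<in> Params n I m" "U' \<in> Params n I m" using X Some LU by simp_all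
    let ?F = "fixp (sgn_step I m u v s) LU"
    have F: "sgn_step I m u v s ?F = ?F" "?F \<in> Params n I m \<times> Params n I m" "narrows {v} (Some LU) (Some ?F)"
      using fixp_sgn_step[OF finite_I uv(2,1) LU'] unfolding LU by blast+
    have eq: "nabla_sign I m u v s X = Some ?F" by (simp add: nabla_sign_def Some)
    have 1: "nabla_sign I m u v s X \<in> lats n I m" using F(2) unfolding eq lats_def by blast
    have 2: "narrows {v} X (nabla_sign I m u v s X)" unfolding eq using F(3) unfolding Some .
    have 3: "P \<in> denote n I m (nabla_sign I m u v s X)"
      if P: "sgn_mono I m u v s P" "P \<in> denote n I m X"
      unfolding eq using P(2) unfolding Some
      by (rule fixp_invariant) (rule sgn_step_sound[OF uv(2,1) P(1)])
    have 4: "sgn_mono I m u v s L \<and> sgn_mono I m u v s U"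
      if "nabla_sign I m u v s X = X" "X = Some (L, U)"
    proof -
      have "?F = (L, U)" using that eq by simp
      then have "sgn_step I m u v s (L, U) = (L, U)" using F(1) by simp
      then show ?thesis using sgn_step_fixed[OF uv(1)] by blast
    qed
    show ?thesis using 1 2 3 4 by blast
  qed
  then show "nabla_sign I m u v s X \<in> lats n I m" "narrows {v} X (nabla_sign I m u v s X)"
    "sgn_mono I m u v s P \<Longrightarrow> P \<in> denote n I m X \<Longrightarrow> P \<in> denote n I m (nabla_sign I m u v s X)"
    "nabla_sign I m u v s X = X \<Longrightarrow> X = Some (L, U) \<Longrightarrow> sgn_mono I m u v s L \<and> sgn_mono I m u v s U"
    by blast+
qed

text \<open>Strictness is what lets \<open>nabla_obs\<close> move a bound by a whole unit without
  losing \<open>P\<close>.\<close>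

lemma unique_peaks_exclude:
  assumes uv: "u \<in> regs I v" and P: "monotone_on (Omega_v I m v) (prec I R v) (\<le>) (P v)"
    "depends (Omega_v I m v) m u (P v)"
    and box: "\<And>\<omega>. \<omega> \<in> Omega_v I m v \<Longrightarrow> L v \<omega> \<le> P v \<omega> \<and> P v \<omega> \<le> U v \<omega>"
  shows "Bover I R v (Aset I m u v L U) L U = {p} \<Longrightarrow> L v p < P v p"
    and "Bunder I R v (Aset I m u v L U) L U = {p} \<Longrightarrow> P v p < U v p"
proof -
  let ?\<Omega> = "Omega_v I m v"
  show "L v p < P v p" if "Bover I R v (Aset I m u v L U) L U = {p}"
  proof -
    have "int (L v p) < int (P v p)"
      using box P(1) P(2)
      by (intro unique_peak_sound[OF uv that[unfolded Bover_eq_peaks Aset_eq_varies], where f = "\<lambda>\<omega>. int (P v \<omega>)"])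
        (auto simp: depends_int monotone_on_def)
    then show ?thesis by simp
  qed
  show "P v p < U v p" if "Bunder I R v (Aset I m u v L U) L U = {p}"
  proof -
    interpret dual: regulator_order ?\<Omega> "\<lambda>a b. prec I R v b a" m "regs I v" by (rule dual)
    have "- int (U v p) < - int (P v p)"
      using box P(1) P(2)
      by (intro dual.unique_peak_sound[OF uv that[unfolded Bunder_eq_peaks Aset_eq_varies_dual], where f = "\<lambda>\<omega>. - int (P v \<omega>)"])
        (auto simp: depends_int monotone_on_def)
    then show ?thesis by simp
  qed
qed

lemma nabla_obs_correct:
  assumes uv: "(u, v, Obs) \<in> R" and X: "X \<in> lats n I m"
  shows "nabla_obs I m R u v X \<in> lats n I m" "narrows {v} X (nabla_obs I m R u v X)"
    and "P \<in> models \<Longrightarrow> P \<in> denote n I m X \<Longrightarrow> P \<in> denote n I m (nabla_obs I m R u v X)"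
    and "nabla_obs I m R u v X = X \<Longrightarrow> X = Some (L, U) \<Longrightarrow> Aset I m u v L U \<noteq> {} \<and>
      (\<nexists>\<omega>. Bover I R v (Aset I m u v L U) L U = {\<omega>}) \<and> (\<nexists>\<omega>. Bunder I R v (Aset I m u v L U) L U = {\<omega>})"
proof -
  have v: "u \<in> regs I v" "v < n" using constraintD[OF uv] by auto
  have "nabla_obs I m R u v X \<in> lats n I m \<and> narrows {v} X (nabla_obs I m R u v X)
    \<and> (P \<in> models \<longrightarrow> P \<in> denote n I m X \<longrightarrow> P \<in> denote n I m (nabla_obs I m R u v X))
    \<and> (nabla_obs I m R u v X = X \<longrightarrow> X = Some (L, U) \<longrightarrow> Aset I m u v L U \<noteq> {} \<and>
      (\<nexists>\<omega>. Bover I R v (Aset I m u v L U) L U = {\<omega>}) \<and> (\<nexists>\<omega>. Bunder I R v (Aset I m u v L U) L U = {\<omega>}))"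
  proof (cases X)
    case None
    then show ?thesis by (simp add: nabla_obs_def narrows_None)
  next
    case (Some LU)
    obtain L' U' where LU: "LU = (L', U')" by (cases LU)
    have XS: "X = Some (L', U')" using Some LU by simp
    have LU': "L' \<in> Params n I m" "U' \<in> Params n I m" using X XS by simp_all
    define A where "A = Aset I m u v L' U'"
    define Bo where "Bo = Bover I R v A L' U'"
    define Bu where "Bu = Bunder I R v A L' U'"
    define L1 where "L1 = (if (\<exists>\<omega>. Bo = {\<omega>}) then pupd L' v (the_elem Bo) (L' v (the_elem Bo) + 1) else L')"
    define U1 where "U1 = (if (\<exists>\<omega>. Bu = {\<omega>}) then pupd U' v (the_elem Bu) (U' v (the_elem Bu) - 1) else U')"
    have eq: "nabla_obs I m R u v X = (if A = {} then None else Some (L1, U1))"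
      by (simp add: nabla_obs_def XS Let_def A_def Bo_def Bu_def L1_def U1_def)
    have o: "p \<in> Omega_v I m v" "L' v p < U' v p" if "Bo = {p}" for p
      using that by (auto simp: Bo_def Bover_def A_def Aset_def)
    have u: "p \<in> Omega_v I m v" "L' v p < U' v p" if "Bu = {p}" for p
      using that by (auto simp: Bu_def Bunder_def A_def Aset_def)
    have L1: "L1 = pupd L' v p (L' v p + 1)" if "Bo = {p}" for p using that by (simp add: L1_def)
    have U1: "U1 = pupd U' v p (U' v p - 1)" if "Bu = {p}" for p using that by (simp add: U1_def)
    have L1n: "L1 = L'" if "\<nexists>p. Bo = {p}" using that by (simp add: L1_def)
    have U1n: "U1 = U'" if "\<nexists>p. Bu = {p}" using that by (simp add: U1_def)
    have upd_Params: "pupd Q v p k \<in> Params n I m"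
      if "Q \<in> Params n I m" "p \<in> Omega_v I m v" "k \<le> m v" for Q p k
      using that v(2) Params_le[OF that(1)] Params_outside[OF that(1)]
      by (intro ParamsI) (auto simp: pupd_def)
    have L1P: "L1 \<in> Params n I m"
    proof (cases "\<exists>p. Bo = {p}")
      case True
      then obtain p where p: "Bo = {p}" by blast
      have "L' v p + 1 \<le> m v" using o[OF p] Params_le[OF LU'(2), of v p] by simp
      then show ?thesis unfolding L1[OF p] using upd_Params[OF LU'(1) o(1)[OF p]] by blast
    next
      case False
      then show ?thesis using L1n LU' by simp
    qed
    have U1P: "U1 \<in> Params n I m"
    proof (cases "\<exists>p. Bu = {p}")
      case True
      then obtain p where p: "Bu = {p}" by blast
      have "U' v p - 1 \<le> m v" using Params_le[OF LU'(2), of v p] by simp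
      then show ?thesis unfolding U1[OF p] using upd_Params[OF LU'(2) u(1)[OF p]] by blast
    next
      case False
      then show ?thesis using U1n LU' by simp
    qed
    have 1: "nabla_obs I m R u v X \<in> lats n I m" unfolding eq using L1P U1P by simp
    have "L' \<le> L1 \<and> (\<forall>w. w \<noteq> v \<longrightarrow> L1 w = L' w)" by (simp add: L1_def pupd_def le_fun_def)
    moreover have "U1 \<le> U' \<and> (\<forall>w. w \<noteq> v \<longrightarrow> U1 w = U' w)" by (simp add: U1_def pupd_def le_fun_def)
    ultimately have 2: "narrows {v} X (nabla_obs I m R u v X)" unfolding eq unfolding XS by (simp add: narrows_def)
    have 3: "P \<in> denote n I m (nabla_obs I m R u v X)" if P: "P \<in> models" "P \<in> denote n I m X"
    proof -
      have adm: "admissible v (P v)" using P(1) Pcon_iff_admissible by (auto simp: models_def)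
      have box: "P \<in> Params n I m" "\<And>w \<omega>. w < n \<Longrightarrow> \<omega> \<in> Omega_v I m w \<Longrightarrow> L' w \<omega> \<le> P w \<omega>"
        "\<And>w \<omega>. w < n \<Longrightarrow> \<omega> \<in> Omega_v I m w \<Longrightarrow> P w \<omega> \<le> U' w \<omega>"
        using P(2) by (auto simp: XS denote_def ple_def)
      have dep: "depends (Omega_v I m v) m u (P v)" using adm uv by (simp add: admissible_def)
      then obtain \<omega> x where \<omega>: "\<omega> \<in> Omega_v I m v" "x \<in> {1..m u}" "P v (\<omega>(u := x)) \<noteq> P v (\<omega>(u := x - 1))"
        unfolding depends_def by blast
      have w: "\<omega>(u := x) \<in> Omega_v I m v" "\<omega>(u := x - 1) \<in> Omega_v I m v"
        using \<omega> v Omega_v_update by auto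
      \<comment> \<open>Two different values of \<open>P\<close> at neighbouring states separate the
        lower bound at the smaller value from the upper bound at the larger one.\<close>
      have "L' v (\<omega>(u := x)) < U' v (\<omega>(u := x - 1)) \<or> U' v (\<omega>(u := x)) > L' v (\<omega>(u := x - 1))"
        using box(2,3)[OF v(2) w(1)] box(2,3)[OF v(2) w(2)] \<omega>(3) by linarith
      then have A: "A \<noteq> {}" unfolding A_def Aset_def using \<omega> by blast
      note ex = unique_peaks_exclude[OF v(1), of P L' U', OF _ dep, folded A_def, folded Bo_def Bu_def]
      have mono: "monotone_on (Omega_v I m v) (prec I R v) (\<le>) (P v)" using adm by (simp add: admissible_def)
      have bv: "L' v \<omega> \<le> P v \<omega> \<and> P v \<omega> \<le> U' v \<omega>" if "\<omega> \<in> Omega_v I m v" for \<omega>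
        using box(2,3)[OF v(2) that] by simp
      have "L1 w \<omega> \<le> P w \<omega>" if "w < n" "\<omega> \<in> Omega_v I m w" for w \<omega>
      proof (cases "\<exists>p. Bo = {p}")
        case True
        then obtain p where p: "Bo = {p}" by blast
        have "L' v p < P v p" by (rule ex(1)[OF mono bv p])
        then show ?thesis using box(2)[OF that] L1[OF p] by (auto simp: pupd_def)
      next
        case False
        then show ?thesis using box(2)[OF that] L1n by simp
      qed
      moreover have "P w \<omega> \<le> U1 w \<omega>" if "w < n" "\<omega> \<in> Omega_v I m w" for w \<omega>
      proof (cases "\<exists>p. Bu = {p}")
        case True
        then obtain p where p: "Bu = {p}" by blast
        have "P v p < U' v p" by (rule ex(2)[OF mono bv p])
        then show ?thesis using box(3)[OF that] U1[OF p] by (auto simp: pupd_def)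
      next
        case False
        then show ?thesis using box(3)[OF that] U1n by simp
      qed
      ultimately show ?thesis unfolding eq using A box(1) by (simp add: denote_def ple_def)
    qed
    have 4: "Aset I m u v L U \<noteq> {} \<and> (\<nexists>\<omega>. Bover I R v (Aset I m u v L U) L U = {\<omega>})
        \<and> (\<nexists>\<omega>. Bunder I R v (Aset I m u v L U) L U = {\<omega>})"
      if fix': "nabla_obs I m R u v X = X" "X = Some (L, U)"
    proof -
      have LU_eq: "L = L'" "U = U'" using fix'(2) XS by auto
      have A: "A \<noteq> {}" and "L1 = L'" "U1 = U'" using fix'(1) XS eq by (auto split: if_splits)
      have "\<nexists>p. Bo = {p}"
      proof
        assume "\<exists>p. Bo = {p}"
        then obtain p where p: "Bo = {p}" by blast
        have "L1 v p = L' v p + 1" using L1[OF p] by (simp add: pupd_def)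
        then show False using \<open>L1 = L'\<close> by simp
      qed
      moreover have "\<nexists>p. Bu = {p}"
      proof
        assume "\<exists>p. Bu = {p}"
        then obtain p where p: "Bu = {p}" by blast
        \<comment> \<open>Subtraction on naturals truncates at 0; \<open>u(2)\<close> makes
          \<open>U' v p\<close> positive, so the decrease is strict.\<close>
        have "U1 v p < U' v p" using U1[OF p] u(2)[OF p] by (simp add: pupd_def)
        then show False using \<open>U1 = U'\<close> by simp
      qed
      ultimately show ?thesis using A unfolding LU_eq A_def Bo_def Bu_def by blast
    qed
    show ?thesis using 1 2 3 4 by blast
  qed
  then show "nabla_obs I m R u v X \<in> lats n I m" "narrows {v} X (nabla_obs I m R u v X)"
    "P \<in> models \<Longrightarrow> P \<in> denote n I m X \<Longrightarrow> P \<in> denote n I m (nabla_obs I m R u v X)"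
    "nabla_obs I m R u v X = X \<Longrightarrow> X = Some (L, U) \<Longrightarrow> Aset I m u v L U \<noteq> {} \<and>
      (\<nexists>\<omega>. Bover I R v (Aset I m u v L U) L U = {\<omega>}) \<and> (\<nexists>\<omega>. Bunder I R v (Aset I m u v L U) L U = {\<omega>})"
    by blast+
qed

lemma nabla_con_correct:
  assumes r: "(u, v, c) \<in> R" and X: "X \<in> lats n I m"
  shows "nabla_con I m R (u, v, c) X \<in> lats n I m" "narrows {v} X (nabla_con I m R (u, v, c) X)"
    "denote n I m X \<inter> models \<subseteq> denote n I m (nabla_con I m R (u, v, c) X)"
proof -
  have uv: "u \<in> regs I v" "v < n" using constraintD[OF r] by auto
  note sg = nabla_sign_correct[OF uv X]
  have "nabla_con I m R (u, v, c) X \<in> lats n I m \<and> narrows {v} X (nabla_con I m R (u, v, c) X)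
    \<and> denote n I m X \<inter> models \<subseteq> denote n I m (nabla_con I m R (u, v, c) X)"
  proof (cases c)
    case Pos
    then have "sgn_mono I m u v 1 P" if "P \<in> models" for P
      using that r sgn_mono_Pos[OF uv(1)] by (auto simp: models_def simp del: Pcon.simps)
    then show ?thesis using sg Pos by (simp add: subset_iff)
  next
    case Neg
    then have "sgn_mono I m u v (-1) P" if "P \<in> models" for P
      using that r sgn_mono_Neg[OF uv(1)] by (auto simp: models_def simp del: Pcon.simps)
    then show ?thesis using sg Neg by (simp add: subset_iff)
  next
    case Obs
    then show ?thesis using nabla_obs_correct[OF _ X] r by (simp add: subset_iff)
  qed
  then show "nabla_con I m R (u, v, c) X \<in> lats n I m" "narrows {v} X (nabla_con I m R (u, v, c) X)"
    "denote n I m X \<inter> models \<subseteq> denote n I m (nabla_con I m R (u, v, c) X)" by blast+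
qed

lemma stableI:
  assumes X: "Some (L, U) \<in> lats n I m"
    and fixed: "\<And>u c. (u, v, c) \<in> R \<Longrightarrow> nabla_con I m R (u, v, c) (Some (L, U)) = Some (L, U)"
  shows "stable v L U"
  unfolding stable_def Let_def
proof (intro allI impI)
  fix u c assume r: "(u, v, c) \<in> R"
  have uv: "u \<in> regs I v" "v < n" using constraintD[OF r] by auto
  note f = fixed[OF r]
  show "if c = Obs then Aset I m u v L U \<noteq> {} \<and> (\<nexists>\<omega>. Bover I R v (Aset I m u v L U) L U = {\<omega>})
      \<and> (\<nexists>\<omega>. Bunder I R v (Aset I m u v L U) L U = {\<omega>})
    else L \<in> Pcon I m (u, v, c) \<and> U \<in> Pcon I m (u, v, c)"
  proof (cases c)
    case Pos
    then show ?thesis using nabla_sign_correct(4)[OF uv X _ refl, of 1] f sgn_mono_Pos[OF uv(1)]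
      by (simp del: Pcon.simps)
  next
    case Neg
    then show ?thesis using nabla_sign_correct(4)[OF uv X _ refl, of "-1"] f sgn_mono_Neg[OF uv(1)]
      by (simp del: Pcon.simps)
  next
    case Obs
    then show ?thesis using nabla_obs_correct(4)[OF _ X _ refl, of u v] r f by simp
  qed
qed

section \<open>Narrowing by a set of constraints\<close>

text \<open>If the whole composition returns \<open>X\<close>, every intermediate result lies
  between \<open>X\<close> and \<open>X\<close> in the order \<open>narrows\<close> and thus equals
  \<open>X\<close>. Hence a fixpoint of the composition is one of each operator.\<close>

lemma nabla_foldr_correct:
  assumes "set rs \<subseteq> R" "\<forall>(u, v, c)\<in>set rs. v \<in> W" "X \<in> lats n I m"
  defines "Y \<equiv> foldr (\<lambda>r g. nabla_con I m R r \<circ> g) rs id X"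
  shows "Y \<in> lats n I m \<and> narrows W X Y \<and> denote n I m X \<inter> models \<subseteq> denote n I m Y
    \<and> (Y = X \<longrightarrow> (\<forall>r\<in>set rs. nabla_con I m R r X = X))"
  using assms(1,2) unfolding Y_def
proof (induction rs)
  case Nil
  then show ?case using assms(3) by (simp add: narrows_refl)
next
  case (Cons r rs)
  let ?Z = "foldr (\<lambda>r g. nabla_con I m R r \<circ> g) rs id X"
  let ?Y = "nabla_con I m R r ?Z"
  have rs: "set rs \<subseteq> R" "\<forall>(u, v, c)\<in>set rs. v \<in> W" using Cons.prems by auto
  have eq: "foldr (\<lambda>r g. nabla_con I m R r \<circ> g) (r # rs) id X = ?Y" by simp
  have IH: "?Z \<in> lats n I m" "narrows W X ?Z" "denote n I m X \<inter> models \<subseteq> denote n I m ?Z"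
    "?Z = X \<Longrightarrow> \<forall>r\<in>set rs. nabla_con I m R r X = X"
    using Cons.IH[OF rs] by blast+
  obtain u v c where r: "r = (u, v, c)" by (cases r)
  have rR: "(u, v, c) \<in> R" "v \<in> W" using Cons.prems r by auto
  note step = nabla_con_correct[OF rR(1) IH(1), folded r]
  have n: "narrows W ?Z ?Y" using narrows_weaken[OF step(2)] rR(2) by simp
  have "\<forall>r\<in>set (r # rs). nabla_con I m R r X = X" if "?Y = X"
  proof -
    have "?Z = X" using narrows_antisym[OF IH(2)] n that by simp
    then show ?thesis using IH(4) that by simp
  qed
  moreover have "narrows W X ?Y" using narrows_trans[OF IH(2) n] .
  moreover have "denote n I m X \<inter> models \<subseteq> denote n I m ?Y" using IH(3) step(3) by blast
  ultimately show ?case unfolding eq using step(1) by blast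
qed

lemma nabla_set_correct:
  assumes "set rs \<subseteq> R" "\<forall>(u, v, c)\<in>set rs. v \<in> W" "X \<in> lats n I m"
  defines "Y \<equiv> nabla_set I m R rs X"
  shows "Y \<in> lats n I m" "narrows W X Y" "denote n I m X \<inter> models \<subseteq> denote n I m Y"
    "\<And>r. r \<in> set rs \<Longrightarrow> nabla_con I m R r Y = Y"
proof -
  let ?f = "foldr (\<lambda>r g. nabla_con I m R r \<circ> g) rs id"
  note f = nabla_foldr_correct[where rs = rs and W = W, OF assms(1) assms(2)]
  have step: "?f Z \<in> lats n I m \<and> narrows W Z (?f Z)" if "Z \<in> lats n I m" for Z
    using f[OF that] by blast
  note fp = fixp_decreasing[OF narrows_order[OF inj_on_id[of UNIV, unfolded id_def]]
      finite_lats[OF finite_I] assms(3) step]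
  have fix': "?f Y = Y" unfolding Y_def nabla_set_def by (rule fp(1)) assumption
  show Y: "Y \<in> lats n I m" unfolding Y_def nabla_set_def by (rule fp(2)) assumption
  show "narrows W X Y" unfolding Y_def nabla_set_def by (rule fp(3)) assumption
  show "nabla_con I m R r Y = Y" if "r \<in> set rs" for r
    using f[OF Y] fix' that by blast
  \<comment> \<open>The invariant includes the carrier because a single step is known to be sound
    only there.\<close>
  have "Y \<in> lats n I m \<and> denote n I m X \<inter> models \<subseteq> denote n I m Y"
    unfolding Y_def nabla_set_def
    by (rule fixp_invariant) (use f assms(3) in blast)+
  then show "denote n I m X \<inter> models \<subseteq> denote n I m Y" by blast
qed

section \<open>Transitions and the abstract parametrisation set\<close>

text \<open>A transition bounds a single coordinate from one side, so a lattice intersected with it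
  is again a lattice and nothing is overapproximated.\<close>

lemma nabla_trans_correct:
  assumes t: "t \<in> Delta n m" and X: "X \<in> lats n I m"
  shows "nabla_trans n I m t X \<in> lats n I m" "narrows {tnode t} X (nabla_trans n I m t X)"
    "denote n I m (nabla_trans n I m t X) = denote n I m X \<inter> Ptrans I t"
proof -
  obtain x y v where xy: "t = (x, y)" "x \<in> States n m" "v < n"
    "x v + 1 \<le> m v \<and> y = x(v := x v + 1) \<or> 1 \<le> x v \<and> y = x(v := x v - 1)"
    using t by (auto simp: Delta_def)
  \<comment> \<open>The two states differ exactly at \<open>v\<close>, so the definite description
    in \<open>tnode\<close> denotes \<open>v\<close>.\<close>
  have ne: "(x w \<noteq> y w) = (w = v)" for w using xy(4) by (auto split: if_splits)
  have v: "tnode t = v" by (simp add: tnode_def xy(1) ne)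
  have x: "fst t = x" using xy(1) by simp
  define w where "w = omega_of I v x"
  have w: "w \<in> Omega_v I m v"
    using I xy(2) by (auto simp: w_def omega_of_def Omega_v_def regs_def States_def)
  have up: "tup t \<Longrightarrow> x v + 1 \<le> m v" using xy(4) unfolding tup_def v unfolding xy(1) by auto
  have "nabla_trans n I m t X \<in> lats n I m \<and> narrows {tnode t} X (nabla_trans n I m t X)
    \<and> denote n I m (nabla_trans n I m t X) = denote n I m X \<inter> Ptrans I t"
  proof (cases X)
    case None
    then show ?thesis by (simp add: nabla_trans_def narrows_None denote_def)
  next
    case (Some LU)
    obtain L U where LU: "LU = (L, U)" by (cases LU)
    have P: "L \<in> Params n I m" "U \<in> Params n I m" using X Some LU by simp_all
    show ?thesis
    proof (cases "tup t")
      case True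
      define L' where "L' = pmaxf L (pupd pbot v w (x v + 1))"
      have L': "L' v' \<omega> = (if v' = v \<and> \<omega> = w then max (L v w) (x v + 1) else L v' \<omega>)" for v' \<omega>
        by (simp add: L'_def pmaxf_def pupd_def pbot_def)
      have eq: "nabla_trans n I m t X = Some (L', U)"
        by (simp add: nabla_trans_def Some LU Let_def v True x w_def L'_def)
      have "L' \<in> Params n I m"
        using Params_le[OF P(1)] Params_outside[OF P(1)] up[OF True] w xy(3)
        by (intro ParamsI) (auto simp: L')
      moreover have "L \<le> L'" "\<forall>v'. v' \<noteq> v \<longrightarrow> L' v' = L v'" by (auto simp: L' le_fun_def)
      moreover have "denote n I m (Some (L', U)) = denote n I m (Some (L, U)) \<inter> Ptrans I t"
      proof -
        have "ple n I m L' Q \<longleftrightarrow> ple n I m L Q \<and> x v + 1 \<le> Q v w" for Q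
        proof
          assume l: "ple n I m L' Q"
          have "L' v w \<le> Q v w" using l xy(3) w unfolding ple_def by blast
          moreover have "L v' \<omega> \<le> Q v' \<omega>" if "v' < n" "\<omega> \<in> Omega_v I m v'" for v' \<omega>
          proof -
            have "L' v' \<omega> \<le> Q v' \<omega>" using l that unfolding ple_def by blast
            then show ?thesis by (auto simp: L' split: if_splits)
          qed
          ultimately show "ple n I m L Q \<and> x v + 1 \<le> Q v w" by (simp add: L' ple_def)
        next
          assume "ple n I m L Q \<and> x v + 1 \<le> Q v w"
          then show "ple n I m L' Q" by (simp add: ple_def L')
        qed
        then show ?thesis by (auto simp: denote_def Ptrans_def Let_def v True x w_def)
      qed
      ultimately show ?thesis unfolding eq unfolding Some LU v using P(2) by (simp add: narrows_def)
    next
      case False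
      define U' where "U' = pminf U (pupd (ptop n I m) v w (x v - 1))"
      \<comment> \<open>Away from \<open>w\<close>, \<open>ptop\<close> is maximal on the carrier
        and 0 outside, where \<open>U\<close> is 0 too, so the minimum returns
        \<open>U\<close>.\<close>
      have U': "U' v' \<omega> = (if v' = v \<and> \<omega> = w then min (U v w) (x v - 1) else U v' \<omega>)" for v' \<omega>
        using Params_le[OF P(2), of v' \<omega>] Params_outside[OF P(2), of v' \<omega>]
        by (auto simp: U'_def pminf_def pupd_def ptop_def)
      have eq: "nabla_trans n I m t X = Some (L, U')"
        by (simp add: nabla_trans_def Some LU Let_def v False x w_def U'_def)
      have "U' \<in> Params n I m"
        using Params_le[OF P(2)] Params_outside[OF P(2)] w xy(3)
        by (intro ParamsI) (auto simp: U' min_le_iff_disj)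
      moreover have "U' \<le> U" "\<forall>v'. v' \<noteq> v \<longrightarrow> U' v' = U v'" by (auto simp: U' le_fun_def)
      moreover have "denote n I m (Some (L, U')) = denote n I m (Some (L, U)) \<inter> Ptrans I t"
      proof -
        have "ple n I m Q U' \<longleftrightarrow> ple n I m Q U \<and> Q v w \<le> x v - 1" for Q
        proof
          assume l: "ple n I m Q U'"
          have "Q v w \<le> U' v w" using l xy(3) w unfolding ple_def by blast
          moreover have "Q v' \<omega> \<le> U v' \<omega>" if "v' < n" "\<omega> \<in> Omega_v I m v'" for v' \<omega>
          proof -
            have "Q v' \<omega> \<le> U' v' \<omega>" using l that unfolding ple_def by blast
            then show ?thesis by (auto simp: U' split: if_splits)
          qed
          ultimately show "ple n I m Q U \<and> Q v w \<le> x v - 1" by (simp add: U' ple_def)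
        next
          assume "ple n I m Q U \<and> Q v w \<le> x v - 1"
          then show "ple n I m Q U'" by (simp add: ple_def U')
        qed
        then show ?thesis by (auto simp: denote_def Ptrans_def Let_def v False x w_def)
      qed
      ultimately show ?thesis unfolding eq unfolding Some LU v using P(1) by (simp add: narrows_def)
    qed
  qed
  then show "nabla_trans n I m t X \<in> lats n I m" "narrows {tnode t} X (nabla_trans n I m t X)"
    "denote n I m (nabla_trans n I m t X) = denote n I m X \<inter> Ptrans I t" by blast+
qed

text \<open>The lattice may be larger than the solution set, but constraint narrowing discards no
  element of \<open>models\<close> and adds nothing, so the intersection with \<open>models\<close>
  stays exact. Stability is recorded at every node because tightness is derived from it
  afterwards.\<close>

lemma psharp_correct:
  assumes rl: "set rl = R" and ts: "set ts \<subseteq> Delta n m"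
  defines "X \<equiv> psharp n I m R rl ts"
  shows "X \<in> lats n I m \<and> (\<forall>L U. X = Some (L, U) \<longrightarrow> (\<forall>v. stable v L U))
    \<and> denote n I m X \<inter> models = pR n I m R (set ts)"
  using ts unfolding X_def
proof (induction ts)
  case Nil
  let ?T = "Some (pbot, ptop n I m)"
  have T: "?T \<in> lats n I m" by (auto simp: pbot_def ptop_def Params_def)
  have dT: "denote n I m ?T = Params n I m"
    by (auto simp: denote_def ple_def pbot_def ptop_def Params_le)
  have eq: "psharp n I m R rl [] = nabla_set I m R rl ?T" by simp
  note c = nabla_set_correct[OF equalityD1[OF rl] _ T, where W = UNIV, simplified, folded eq]
  have "stable v L U" if "psharp n I m R rl [] = Some (L, U)" for v L U
    using stableI c(1,4) that rl by metis
  moreover have "denote n I m (psharp n I m R rl []) \<inter> models = pR n I m R (set [])"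
    using c(3) denote_narrows[OF c(2), of n I m] unfolding dT by (auto simp: models_def pR_def pT_def)
  ultimately show ?case using c(1) by blast
next
  case (Cons t ts)
  let ?X = "psharp n I m R rl ts" and ?rs = "filter (\<lambda>(u, v', c). v' = tnode t) rl"
  let ?Y = "nabla_trans n I m t ?X"
  let ?Z = "psharp n I m R rl (t # ts)"
  have IH: "?X \<in> lats n I m" "\<And>L U v. ?X = Some (L, U) \<Longrightarrow> stable v L U"
    "denote n I m ?X \<inter> models = pR n I m R (set ts)" using Cons by auto
  have "t \<in> Delta n m" using Cons.prems by simp
  note Y = nabla_trans_correct[OF this IH(1)]
  have eq: "?Z = nabla_set I m R ?rs ?Y" by simp
  have rs: "set ?rs \<subseteq> R" "\<forall>(u, v, c)\<in>set ?rs. v \<in> {tnode t}" using rl by auto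
  note Z = nabla_set_correct[OF rs Y(1), folded eq]
  have XZ: "narrows {tnode t} ?X ?Z" using narrows_trans[OF Y(2) Z(2)] .
  \<comment> \<open>At the node of \<open>t\<close> the constraints have just been narrowed to a
    fixpoint; at any other node neither bound has changed, so stability is inherited.\<close>
  have "stable v L U" if ZS: "?Z = Some (L, U)" for v L U
  proof (cases "v = tnode t")
    case True
    show ?thesis
    proof (rule stableI)
      show "Some (L, U) \<in> lats n I m" using Z(1) unfolding ZS .
      fix u c assume "(u, v, c) \<in> R"
      then have "(u, v, c) \<in> set ?rs" using True rl by simp
      then show "nabla_con I m R (u, v, c) (Some (L, U)) = Some (L, U)" using Z(4) unfolding ZS by blast
    qed
  next
    case False
    obtain L' U' where "?X = Some (L', U')" "L v = L' v" "U v = U' v"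
      using XZ False unfolding ZS narrows_def by auto
    then show ?thesis using IH(2) stable_cong by blast
  qed
  moreover have "denote n I m ?Z \<inter> models = pR n I m R (set (t # ts))"
  proof -
    have "pR n I m R (set (t # ts)) = pR n I m R (set ts) \<inter> Ptrans I t"
      by (auto simp: pR_def pT_def)
    also have "\<dots> = denote n I m ?Y \<inter> models" using IH(3) Y(3) by blast
    also have "\<dots> = denote n I m ?Z \<inter> models" using Z(3) denote_narrows[OF Z(2), of n I m] by blast
    finally show ?thesis ..
  qed
  ultimately show ?case using Z(1) by blast
qed

section \<open>From bounds attained at each node to the hull\<close>

text \<open>Each bound is attained by an admissible function at its node. As constraints split by
  node, any admissible functions within the bounds at the other nodes complete it to a full
  parametrisation.\<close>

lemma denote_stable:
  assumes st: "\<And>v. stable v L U" and X: "Some (L, U) \<in> lats n I m"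
  shows "denote n I m (Some (L, U)) = hull n I m (denote n I m (Some (L, U)) \<inter> models)"
proof (cases "ple n I m L U")
  case False
  \<comment> \<open>A pair with \<open>L\<close> not below \<open>U\<close> is empty without being
    \<open>None\<close>; both sides are then empty.\<close>
  then have "denote n I m (Some (L, U)) = {}"
    by (auto simp: denote_def ple_def) (meson order_trans)
  then show ?thesis by (simp add: hull_def)
next
  case True
  let ?D = "denote n I m (Some (L, U)) \<inter> models"
  have P: "L \<in> Params n I m" "U \<in> Params n I m" using X by auto
  have box: "L v \<omega> \<le> U v \<omega>" if "\<omega> \<in> Omega_v I m v" for v \<omega>
    using True that Params_outside[OF P(1), of v \<omega>] by (cases "v < n") (auto simp: ple_def)
  define ok where "ok v h \<longleftrightarrow> admissible v h \<and> (\<forall>\<omega>\<in>Omega_v I m v. L v \<omega> \<le> h \<omega> \<and> h \<omega> \<le> U v \<omega>)" for v h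
  have att: "\<exists>h. ok v h \<and> h p = L v p" "\<exists>h. ok v h \<and> h p = U v p" if "p \<in> Omega_v I m v" for v p
    using stable_bounds_attained[OF st that box] unfolding ok_def by simp_all
  \<comment> \<open>Attainment needs a point to start from; the zero state exists at every node and
    yields the default functions \<open>g\<close>.\<close>
  have zero: "(\<lambda>_. 0) \<in> Omega_v I m v" for v by (simp add: Omega_v_def)
  have "\<exists>h. ok v h" for v using att(1)[OF zero] by blast
  then obtain g where g: "\<And>v. ok v (g v)" by metis
  have mem: "\<exists>Q\<in>?D. \<forall>\<omega>\<in>Omega_v I m v. Q v \<omega> = h \<omega>" if v: "v < n" and h: "ok v h" for v h
  proof
    define Q where "Q w \<omega> = (if w < n \<and> \<omega> \<in> Omega_v I m w then (g(v := h)) w \<omega> else 0)" for w \<omega>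
    have ok: "ok w ((g(v := h)) w)" for w using g h by simp
    have Qeq: "Q w \<omega> = (g(v := h)) w \<omega>" if "w < n" "\<omega> \<in> Omega_v I m w" for w \<omega> using that by (simp add: Q_def)
    have Qbox: "L w \<omega> \<le> Q w \<omega> \<and> Q w \<omega> \<le> U w \<omega>" if "w < n" "\<omega> \<in> Omega_v I m w" for w \<omega>
      using ok[of w] Qeq[OF that] that unfolding ok_def by simp
    have "Q \<in> Params n I m"
    proof (rule ParamsI)
      show "Q w \<omega> \<le> m w" if "w < n" "\<omega> \<in> Omega_v I m w" for w \<omega>
        using Qbox[OF that] Params_le[OF P(2), of w \<omega>] by simp
    qed (auto simp: Q_def)
    moreover have "admissible w (Q w)" for w
    proof (cases "w < n")
      case True
      have "\<omega>(u := x) \<in> Omega_v I m w" "\<omega>(u := x - 1) \<in> Omega_v I m w"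
        if "(u, w, Obs) \<in> R" "\<omega> \<in> Omega_v I m w" "x \<in> {1..m u}" for u \<omega> x
        using that constraintD[OF that(1)] Omega_v_update by auto
      then show ?thesis using ok[of w] Qeq[OF True] unfolding ok_def admissible_def depends_def monotone_on_def
        by (metis (no_types, lifting))
    next
      case False
      then have "(u, w, c) \<notin> R" for u c using constraintD by blast
      then show ?thesis using False by (simp add: admissible_def monotone_on_def Q_def)
    qed
    ultimately show "Q \<in> ?D"
      using Qbox by (simp add: models_def Pcon_iff_admissible denote_def ple_def)
    show "\<forall>\<omega>\<in>Omega_v I m v. Q v \<omega> = h \<omega>" using Qeq[OF v] by simp
  qed
  have "?D \<noteq> {}"
  proof (cases "0 < n")
    case True
    then show ?thesis using mem[OF _ g] by blast
  next
    case False
    \<comment> \<open>Without nodes \<open>mem\<close> has nothing to start from; here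
      \<open>R\<close> is empty and the zero parametrisation is a model.\<close>
    then have "(\<lambda>_ _. 0) \<in> denote n I m (Some (L, U))" by (simp add: denote_def Params_def ple_def)
    moreover have "\<forall>r\<in>R. (\<lambda>_ _. 0) \<in> Pcon I m r" using constraintD False by fastforce
    ultimately show ?thesis by (auto simp: models_def denote_def)
  qed
  moreover have "Min ((\<lambda>Q. Q v \<omega>) ` ?D) = L v \<omega> \<and> Max ((\<lambda>Q. Q v \<omega>) ` ?D) = U v \<omega>"
    if v: "v < n" "\<omega> \<in> Omega_v I m v" for v \<omega>
  proof -
    have fin: "finite ((\<lambda>Q. Q v \<omega>) ` ?D)"
      using finite_Params[OF finite_I] by (auto simp: denote_def models_def)
    have b: "L v \<omega> \<le> Q v \<omega> \<and> Q v \<omega> \<le> U v \<omega>" if "Q \<in> ?D" for Q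
      using that v by (auto simp: denote_def ple_def)
    have img: "h \<omega> \<in> (\<lambda>Q. Q v \<omega>) ` ?D" if h: "ok v h" for h
    proof -
      obtain Q where "Q \<in> ?D" "Q v \<omega> = h \<omega>" using mem[OF v(1) h] v(2) by blast
      then show ?thesis by (metis imageI)
    qed
    have "L v \<omega> \<in> (\<lambda>Q. Q v \<omega>) ` ?D" using att(1)[OF v(2)] img by metis
    moreover have "U v \<omega> \<in> (\<lambda>Q. Q v \<omega>) ` ?D" using att(2)[OF v(2)] img by metis
    ultimately show ?thesis using b by (intro conjI Min_eqI[OF fin] Max_eqI[OF fin]) blast+
  qed
  ultimately show ?thesis by (auto simp: hull_def denote_def ple_def)
qed

end

text \<open>The lists enumerate \<open>T\<close> and \<open>R\<close>. The right-hand side sees only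
  the sets, so the denoted lattice does not depend on the order in which transitions are added or
  constraints composed.\<close>

theorem theorem2:
  fixes n :: nat and I :: "(nat \<times> nat) set" and m :: "nat \<Rightarrow> nat"
    and R :: "(nat \<times> nat \<times> sgn) set" and rl :: "(nat \<times> nat \<times> sgn) list"
    and ts :: "trans list"
  assumes "I \<subseteq> {..<n} \<times> {..<n}"
    and "wf_constraints I R"
    and "set rl = R" and "distinct rl"
    and "set ts \<subseteq> Delta n m" and "distinct ts"
  shows "denote n I m (psharp n I m R rl ts) = hull n I m (pR n I m R (set ts))"
proof -
  interpret influence_constraints n I m R using assms(1,2) by unfold_locales
  note X = psharp_correct[OF assms(3,5)]
  show ?thesis
  proof (cases "psharp n I m R rl ts")
    case None
    then show ?thesis using X by (auto simp: denote_def hull_def)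
  next
    case (Some LU)
    then show ?thesis using X denote_stable by (cases LU) metis
  qed
qed

end
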